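(* Let $n\ge 2$ and let $\mathcal{S}=\{\rho_1,\dots,\rho_N\}$ be a finite set of states of an $n$-partite quantum system. If $\mathcal{S}$ is perfectly discriminable under LOCC, then $\mathcal{S}$ admits complete local random authentication (complete LRA). The converse is false: there exists a finite set of mutually orthogonal multipartite quantum states that admits complete LRA but is not perfectly discriminable under LOCC.
   Context: An $n$-partite system ($n\ge 2$) has Hilbert space $\bigotimes_{k=1}^n\mathbb{C}^{d_k}$, each tensor factor being held by a different spatially separated party $B_k$. A state is a density operator on this space (pure states $|\psi\rangle$ are identified with $|\psi\rangle\langle\psi|$); states $\rho,\sigma$ are orthogonal if $\operatorname{Tr}(\rho\sigma)=0$. LOCC has its standard meaning: a protocol with finitely many rounds of local quantum measurements by individual parties and classical communication among all of them; a POVM is LOCC-implementable if its outcome statistics are produced by such a protocol (including classical post-processing). Perfect LOCC discrimination: $\mathcal{S}=\{\rho_1,\dots,\rho_N\}$ is perfectly discriminable under LOCC if there is an LOCC-implementable POVM $\{M_1,\dots,M_N\}$ with $\operatorname{Tr}(M_j\rho_i)=\delta_{ij}$ for all $i,j$. Local random authentication (LRA): an unknown state from the known set $\mathcal{S}$ is shared by the parties, and they receive a question $\mathcal{Q}_i$, "is the shared state $\rho_i$ or not?", $i\in\{1,\dots,N\}$, chosen independently of the shared state; their LOCC protocol may depend on $i$. The question $\mathcal{Q}_i$ can be perfectly answered under LOCC (equivalently, $\rho_i$ can be authenticated locally in $\mathcal{S}$) if there is a two-outcome LOCC-implementable POVM $\{M_i^{(0)},M_i^{(1)}\}$ with $\operatorname{Tr}(M_i^{(1)}\rho_i)=1$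 and $\operatorname{Tr}(M_i^{(1)}\rho_j)=0$ for all $j\ne i$. The set $\mathcal{S}$ admits complete LRA if every question $\mathcal{Q}_1,\dots,\mathcal{Q}_N$ can be perfectly answered under LOCC. *)

theory Defs
  imports "Jordan_Normal_Form.Schur_Decomposition"
begin

section \<open>Multipartite operators\<close>

definition tr :: "complex mat \<Rightarrow> complex" where
  "tr A = (\<Sum>i<dim_row A. A $$ (i, i))"

definition sum_ops :: "nat \<Rightarrow> ('i \<Rightarrow> complex mat) \<Rightarrow> 'i set \<Rightarrow> complex mat" where
  "sum_ops d M I = mat d d (\<lambda>ij. \<Sum>x\<in>I. M x $$ ij)"

definition kron :: "complex mat \<Rightarrow> complex mat \<Rightarrow> complex mat" where
  "kron A B = mat (dim_row A * dim_row B) (dim_col A * dim_col B)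
     (\<lambda>(i, j). A $$ (i div dim_row B, j div dim_col B) * B $$ (i mod dim_row B, j mod dim_col B))"

definition tensor :: "complex mat list \<Rightarrow> complex mat" where
  "tensor As = foldr kron As (1\<^sub>m 1)"

text \<open>
  A system is given by the list \<open>ds\<close> of its local dimensions; its parties are the positions
  \<open>k < length ds\<close>, and its operators are matrices of size \<open>prod_list ds\<close>.
\<close>

definition multipartite_system :: "nat list \<Rightarrow> bool" where
  "multipartite_system ds \<longleftrightarrow> length ds \<ge> 2 \<and> (\<forall>d\<in>set ds. d > 0)"

text \<open>\<open>I \<otimes> \<dots> \<otimes> K \<otimes> \<dots> \<otimes> I\<close> with \<open>K\<close> at party \<open>k\<close>; \<open>K\<close> may be rectangular.\<close>

definition local_op :: "nat list \<Rightarrow> nat \<Rightarrow> complex mat \<Rightarrow> complex mat" where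
  "local_op ds k K = tensor ((map 1\<^sub>m ds)[k := K])"

text \<open>
  The order on \<^typ>\<open>complex\<close> used below is the one in which \<open>z \<ge> 0\<close> means that \<open>z\<close> is real
  and nonnegative, so positivity entails that the operator is Hermitian.
\<close>

definition positive_op :: "nat \<Rightarrow> complex mat \<Rightarrow> bool" where
  "positive_op d A \<longleftrightarrow> A \<in> carrier_mat d d \<and> (\<forall>v\<in>carrier_vec d. (A *\<^sub>v v) \<bullet>c v \<ge> 0)"

definition states :: "nat list \<Rightarrow> complex mat set" where
  "states ds = {\<rho>. positive_op (prod_list ds) \<rho> \<and> tr \<rho> = 1}"

definition orthogonal_states :: "complex mat \<Rightarrow> complex mat \<Rightarrow> bool" where
  "orthogonal_states \<rho> \<sigma> \<longleftrightarrow> tr (\<rho> * \<sigma>) = 0"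

definition state_set :: "nat list \<Rightarrow> complex mat set \<Rightarrow> bool" where
  "state_set ds S \<longleftrightarrow> finite S \<and> S \<noteq> {} \<and> S \<subseteq> states ds"

definition povm :: "nat list \<Rightarrow> 'a set \<Rightarrow> ('a \<Rightarrow> complex mat) \<Rightarrow> bool" where
  "povm ds X M \<longleftrightarrow> finite X \<and> (\<forall>x\<in>X. positive_op (prod_list ds) (M x)) \<and>
     sum_ops (prod_list ds) M X = 1\<^sub>m (prod_list ds)"


section \<open>LOCC protocols\<close>

text \<open>
  A protocol is a finite tree. At a node \<open>Measure k bs\<close> party \<open>k\<close> performs the measurement whose
  Kraus operators are the first components of \<open>bs\<close> and announces the result to everybody; the
  remaining protocol depends on that result. So the position in the tree is the complete classical
  record, and the labels of the leaves are its post-processing. A measurement whose outcomes have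
  several Kraus operators is covered by repeating the same continuation, and classical randomness
  by Kraus operators that are multiples of the identity.
\<close>

datatype (labels: 'a) protocol =
  Output 'a
| Measure nat "(complex mat \<times> 'a protocol) list"

text \<open>A Kraus operator may change the dimension of the system of the measuring party.\<close>

fun valid_protocol :: "nat list \<Rightarrow> 'a protocol \<Rightarrow> bool" where
  "valid_protocol ds (Output a) \<longleftrightarrow> True"
| "valid_protocol ds (Measure k bs) \<longleftrightarrow>
     k < length ds \<and>
     (\<forall>(K, P)\<in>set bs. dim_col K = ds ! k \<and> dim_row K > 0 \<and> valid_protocol (ds[k := dim_row K]) P) \<and>
     sum_ops (ds ! k) (\<lambda>i. mat_adjoint (fst (bs ! i)) * fst (bs ! i)) {..<length bs} = 1\<^sub>m (ds ! k)"

text \<open>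
  Probability of the final output \<open>x\<close> on input \<open>\<rho>\<close>. The recursion carries the unnormalised
  post-measurement state, whose trace is the probability of the branch.
\<close>

fun output_prob :: "nat list \<Rightarrow> 'a protocol \<Rightarrow> 'a \<Rightarrow> complex mat \<Rightarrow> complex" where
  "output_prob ds (Output a) x \<rho> = (if a = x then tr \<rho> else 0)"
| "output_prob ds (Measure k bs) x \<rho> =
     (\<Sum>(K, P)\<leftarrow>bs. output_prob (ds[k := dim_row K]) P x
        (local_op ds k K * \<rho> * mat_adjoint (local_op ds k K)))"

definition locc_povm :: "nat list \<Rightarrow> 'a set \<Rightarrow> ('a \<Rightarrow> complex mat) \<Rightarrow> bool" where
  "locc_povm ds X M \<longleftrightarrow> povm ds X M \<and>
     (\<exists>P. valid_protocol ds P \<and> labels P \<subseteq> X \<and>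
        (\<forall>\<rho>\<in>states ds. \<forall>x\<in>X. tr (M x * \<rho>) = output_prob ds P x \<rho>))"


section \<open>Discrimination and authentication\<close>

text \<open>The members of \<open>S\<close> themselves serve as indices of the POVM elements.\<close>

definition perfectly_discriminable :: "nat list \<Rightarrow> complex mat set \<Rightarrow> bool" where
  "perfectly_discriminable ds S \<longleftrightarrow>
     (\<exists>M. locc_povm ds S M \<and> (\<forall>\<rho>\<in>S. \<forall>\<sigma>\<in>S. tr (M \<sigma> * \<rho>) = (if \<sigma> = \<rho> then 1 else 0)))"

text \<open>\<open>M True\<close> and \<open>M False\<close> are the answers yes and no to the question whether the state is \<open>\<rho>\<close>.\<close>

definition locally_authenticable :: "nat list \<Rightarrow> complex mat set \<Rightarrow> complex mat \<Rightarrow> bool" where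
  "locally_authenticable ds S \<rho> \<longleftrightarrow>
     (\<exists>M. locc_povm ds (UNIV :: bool set) M \<and> tr (M True * \<rho>) = 1 \<and>
        (\<forall>\<sigma>\<in>S - {\<rho>}. tr (M True * \<sigma>) = 0))"

definition complete_LRA :: "nat list \<Rightarrow> complex mat set \<Rightarrow> bool" where
  "complete_LRA ds S \<longleftrightarrow> (\<forall>\<rho>\<in>S. locally_authenticable ds S \<rho>)"

end

(*
  A product state is authenticated by letting every party test her own factor: the state is confirmed
  iff all local projections succeed. Hence every set of mutually orthogonal product states admits
  complete LRA, and it suffices to exhibit one that is not perfectly discriminable under LOCC. The four
  SHIFT states of three qubits will do. Perfect discrimination forces every local measurement to keep
  the states orthogonal, and for the SHIFT states this forces each K^* K to be a multiple of the
  identity. So along every branch of the protocol the states are only moved by local isometries, up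
  to scalars, and nothing is ever learned.
*)

theory Submission
  imports Defs
begin

section \<open>Matrices and traces\<close>

text \<open>Orthogonality is forced from the leaves upwards. A leaf carries one label, and a label
  has probability zero on all states but one, so of two vectors arriving at a leaf one vanishes. A
  complete measurement preserves \<open>tr X\<close> not only for states but also for
  \<open>X = B * mat_adjoint A\<close>, so the inner products over the branches add up to the inner
  product at the node, and vanishing climbs to every node of the tree. Two obstacles shape the
  downward induction. Kraus operators may be rectangular, so the current spaces vary; the induction
  therefore keeps the maps \<open>Vs ! k\<close> from the original local spaces and pulls each
  measurement back to \<open>E\<close>, the adjoint of \<open>K * Vs ! k\<close> times itself, which
  always acts on the original space. And a branch may have probability zero, so the path is chosen
  through branches that the state \<open>a\<close> reaches with nonzero trace. Since two SHIFT
  states are orthogonal at a single party only, the overlaps at the other parties cancel and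
  orthogonality after a measurement becomes a linear equation for the entries of
  \<open>E\<close>.\<close>

lemma dim_mat_adjoint [simp]:
  "dim_row (mat_adjoint A) = dim_col A" "dim_col (mat_adjoint A) = dim_row A"
  by (auto simp: mat_adjoint_def)

lemma mat_adjoint_carrier [simp, intro]:
  "A \<in> carrier_mat n m \<Longrightarrow> mat_adjoint A \<in> carrier_mat m n"
  by (metis carrier_matD carrier_matI dim_mat_adjoint)

lemma mat_adjoint_index [simp]:
  fixes A :: "complex mat"
  shows "i < dim_col A \<Longrightarrow> j < dim_row A \<Longrightarrow> mat_adjoint A $$ (i, j) = cnj (A $$ (j, i))"
  by (simp add: mat_adjoint_def mat_of_rows_def conjugate_complex_def)

lemma mat_mult_index_sum:
  "i < dim_row A \<Longrightarrow> j < dim_col B \<Longrightarrow> dim_col A = dim_row B \<Longrightarrow>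
    (A * B) $$ (i, j) = (\<Sum>l<dim_row B. A $$ (i, l) * B $$ (l, j))"
  by (simp add: scalar_prod_def lessThan_atLeast0)

lemma mat_adjoint_mult:
  fixes A :: "complex mat"
  assumes "dim_col A = dim_row B"
  shows "mat_adjoint (A * B) = mat_adjoint B * mat_adjoint A"
  by (rule eq_matI)
    (use assms in \<open>auto simp: mat_mult_index_sum mult.commute simp del: index_mult_mat(1)\<close>)

lemma mat_adjoint_adjoint [simp]: "mat_adjoint (mat_adjoint (A :: complex mat)) = A"
  by (rule eq_matI) auto

lemma mat_adjoint_one [simp]: "mat_adjoint (1\<^sub>m n :: complex mat) = 1\<^sub>m n"
  by (rule eq_matI) auto

lemma mat_adjoint_minus:
  fixes A :: "complex mat"
  assumes "A \<in> carrier_mat n m" "B \<in> carrier_mat n m"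
  shows "mat_adjoint (A - B) = mat_adjoint A - mat_adjoint B"
  by (rule eq_matI) (use assms in auto)

lemma mult_assoc_dim:
  fixes A :: "'a :: semiring_0 mat"
  shows "dim_col A = dim_row B \<Longrightarrow> dim_col B = dim_row C \<Longrightarrow> A * B * C = A * (B * C)"
  by (rule assoc_mult_mat[of _ "dim_row A" "dim_col A" _ "dim_col B" _ "dim_col C"]) auto

section \<open>Positive operators and finite operator sums\<close>

lemma positive_op_adjoint_mult:
  assumes A: "A \<in> carrier_mat m n"
  shows "positive_op n (mat_adjoint A * A)"
  unfolding positive_op_def
proof (intro conjI ballI)
  show "mat_adjoint A * A \<in> carrier_mat n n" using A by auto
  fix v :: "complex vec" assume v: "v \<in> carrier_vec n"
  have "((mat_adjoint A * A) *\<^sub>v v) \<bullet>c v = (mat_adjoint A *\<^sub>v (A *\<^sub>v v)) \<bullet>c v"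
    using A v by (subst assoc_mult_mat_vec[of _ n m _ n]) auto
  also have "\<dots> = (\<Sum>i<n. (\<Sum>j<m. cnj (A $$ (j, i)) * (A *\<^sub>v v) $ j) * cnj (v $ i))"
    using A v by (auto simp: scalar_prod_def lessThan_atLeast0 intro!: sum.cong)
  also have "\<dots> = (\<Sum>j<m. \<Sum>i<n. cnj (A $$ (j, i)) * (A *\<^sub>v v) $ j * cnj (v $ i))"
    by (simp add: sum_distrib_right) (rule sum.swap)
  also have "\<dots> = (A *\<^sub>v v) \<bullet>c (A *\<^sub>v v)"
    using A v by (auto simp: scalar_prod_def lessThan_atLeast0 sum_distrib_left mult_ac intro!: sum.cong)
  also have "\<dots> \<ge> 0" using A v by (intro conjugate_square_ge_0_vec)
  finally show "0 \<le> ((mat_adjoint A * A) *\<^sub>v v) \<bullet>c v" .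
qed

lemma positive_op_mult_adjoint:
  "A \<in> carrier_mat n m \<Longrightarrow> positive_op n (A * mat_adjoint A)"
  using positive_op_adjoint_mult[of "mat_adjoint A" m n] by auto

lemma sum_ops_carrier [simp]: "sum_ops d M I \<in> carrier_mat d d"
  "dim_row (sum_ops d M I) = d" "dim_col (sum_ops d M I) = d"
  by (auto simp: sum_ops_def)

lemma sum_ops_index [simp]:
  "i < d \<Longrightarrow> j < d \<Longrightarrow> sum_ops d M I $$ (i, j) = (\<Sum>x\<in>I. M x $$ (i, j))"
  by (simp add: sum_ops_def)

lemma sum_ops_cong: "I = J \<Longrightarrow> (\<And>x. x \<in> J \<Longrightarrow> M x = N x) \<Longrightarrow> sum_ops d M I = sum_ops d N J"
  by (simp add: sum_ops_def)

lemma sum_ops_mult_right: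
  assumes "\<And>x. x \<in> I \<Longrightarrow> M x \<in> carrier_mat d d" "A \<in> carrier_mat d d"
  shows "sum_ops d M I * A = sum_ops d (\<lambda>x. M x * A) I"
proof (rule eq_matI, goal_cases)
  case (1 i j)
  then have "(sum_ops d M I * A) $$ (i, j) = (\<Sum>l<d. \<Sum>x\<in>I. M x $$ (i, l) * A $$ (l, j))"
    using assms by (simp add: mat_mult_index_sum sum_distrib_right del: index_mult_mat(1))
  also have "\<dots> = (\<Sum>x\<in>I. \<Sum>l<d. M x $$ (i, l) * A $$ (l, j))" by (rule sum.swap)
  also have "\<dots> = (\<Sum>x\<in>I. (M x * A) $$ (i, j))"
    using assms 1
  proof (intro sum.cong refl)
    fix x assume "x \<in> I"
    from assms(1)[OF this] 1 assms(2)
    show "(\<Sum>l<d. M x $$ (i, l) * A $$ (l, j)) = (M x * A) $$ (i, j)"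
      by (subst mat_mult_index_sum) auto
  qed
  finally show ?case using 1 by simp
qed (use assms in auto)

lemma positive_op_sum_ops:
  assumes "finite I" "\<And>x. x \<in> I \<Longrightarrow> positive_op d (M x)"
  shows "positive_op d (sum_ops d M I)"
  unfolding positive_op_def
proof (intro conjI ballI)
  fix v :: "complex vec" assume v: "v \<in> carrier_vec d"
  have c: "M x \<in> carrier_mat d d" if "x \<in> I" for x using assms(2)[OF that] by (simp add: positive_op_def)
  have "(sum_ops d M I *\<^sub>v v) \<bullet>c v = (\<Sum>i<d. (\<Sum>j<d. \<Sum>x\<in>I. M x $$ (i, j) * v $ j) * cnj (v $ i))"
    using v by (auto simp: scalar_prod_def lessThan_atLeast0 sum_distrib_right intro!: sum.cong)
  also have "\<dots> = (\<Sum>i<d. (\<Sum>x\<in>I. \<Sum>j<d. M x $$ (i, j) * v $ j) * cnj (v $ i))"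
    by (subst sum.swap) simp
  also have "\<dots> = (\<Sum>x\<in>I. \<Sum>i<d. (\<Sum>j<d. M x $$ (i, j) * v $ j) * cnj (v $ i))"
    by (subst sum.swap) (simp add: sum_distrib_right)
  also have "\<dots> = (\<Sum>x\<in>I. (M x *\<^sub>v v) \<bullet>c v)"
  proof (intro sum.cong refl)
    fix x assume "x \<in> I"
    from c[OF this] v show "(\<Sum>i<d. (\<Sum>j<d. M x $$ (i, j) * v $ j) * cnj (v $ i)) = (M x *\<^sub>v v) \<bullet>c v"
      by (auto simp: scalar_prod_def lessThan_atLeast0 intro!: sum.cong)
  qed
  also have "\<dots> \<ge> 0" using assms(2) v by (intro sum_nonneg) (auto simp: positive_op_def)
  finally show "0 \<le> (sum_ops d M I *\<^sub>v v) \<bullet>c v" .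
qed simp

section \<open>Traces of products and rank-one projections\<close>

lemma tr_mult:
  assumes "dim_col A = dim_row B" "dim_col B = dim_row A"
  shows "tr (A * B) = (\<Sum>i<dim_row A. \<Sum>j<dim_col A. A $$ (i, j) * B $$ (j, i))"
  using assms by (simp add: tr_def mat_mult_index_sum del: index_mult_mat(1))

lemma tr_mult_commute:
  assumes "dim_col A = dim_row B" "dim_col B = dim_row A"
  shows "tr (A * B) = tr (B * A)"
  unfolding tr_mult[OF assms] tr_mult[OF assms(2,1)] using assms
  by (subst sum.swap) (simp add: mult.commute)

lemma tr_sum_ops:
  assumes "\<And>x. x \<in> I \<Longrightarrow> M x \<in> carrier_mat d d"
  shows "tr (sum_ops d M I) = (\<Sum>x\<in>I. tr (M x))"
proof -
  have "(\<Sum>x\<in>I. tr (M x)) = (\<Sum>x\<in>I. \<Sum>i<d. M x $$ (i, i))"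
    using assms
  proof (intro sum.cong refl)
    fix x assume "x \<in> I"
    from assms[OF this] show "tr (M x) = (\<Sum>i<d. M x $$ (i, i))" by (simp add: tr_def)
  qed
  also have "\<dots> = (\<Sum>i<d. \<Sum>x\<in>I. M x $$ (i, i))" by (rule sum.swap)
  finally show ?thesis by (simp add: tr_def)
qed

lemma tr_sum_ops_mult:
  assumes "\<And>x. x \<in> I \<Longrightarrow> M x \<in> carrier_mat d d" "A \<in> carrier_mat d d"
  shows "tr (sum_ops d M I * A) = (\<Sum>x\<in>I. tr (M x * A))"
proof -
  have "M x * A \<in> carrier_mat d d" if "x \<in> I" for x
    using assms(1)[OF that] assms(2) by simp
  with assms show ?thesis by (subst sum_ops_mult_right) (auto intro: tr_sum_ops)
qed

lemma tr_mult_adjoint_nonneg: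
  "tr (A * mat_adjoint A) \<ge> 0"
  by (subst tr_mult) (auto intro!: sum_nonneg simp: complex_norm_square[symmetric] less_eq_complex_def)

text \<open>For columns \<open>u\<close> and \<open>v\<close> the inner product of \<open>u\<close> with \<open>v\<close> is \<open>tr (v * mat_adjoint u)\<close>.\<close>

lemma adjoint_mult_columns:
  assumes "v \<in> carrier_mat n 1" "u \<in> carrier_mat n 1"
  shows "mat_adjoint u * v = tr (v * mat_adjoint u) \<cdot>\<^sub>m 1\<^sub>m 1"
proof (rule eq_matI, goal_cases)
  case (1 i j)
  then have "i = 0" "j = 0" by auto
  with assms show ?case
    by (simp add: tr_mult mat_mult_index_sum mult.commute del: index_mult_mat(1))
qed (use assms in auto)

text \<open>Reassociating puts the product of a row and a column in the middle; it is a 1 x 1 matrix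
  and leaves the trace as a scalar.\<close>

lemma tr_mult_projections:
  assumes v: "v \<in> carrier_mat n 1" and u: "u \<in> carrier_mat n 1"
  shows "tr ((u * mat_adjoint u) * (v * mat_adjoint v)) = tr (v * mat_adjoint u) * tr (u * mat_adjoint v)"
proof -
  have "(u * mat_adjoint u) * (v * mat_adjoint v) = u * ((mat_adjoint u * v) * mat_adjoint v)"
    using u v by (simp add: mult_assoc_dim)
  also have "\<dots> = tr (v * mat_adjoint u) \<cdot>\<^sub>m (u * mat_adjoint v)"
    using u v by (simp add: adjoint_mult_columns[OF v u] mult_smult_distrib[of _ n 1 _ n]
      smult_carrier_mat mult_smult_assoc_mat[of _ 1 1 _ n] left_mult_one_mat[of _ 1 n])
  finally show ?thesis by (simp add: tr_def sum_distrib_left u v)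
       (use u v in auto)
qed

lemma projection_idem:
  assumes u: "u \<in> carrier_mat n 1" and 1: "tr (u * mat_adjoint u) = 1"
  shows "(u * mat_adjoint u) * (u * mat_adjoint u) = u * mat_adjoint u"
proof -
  have "(u * mat_adjoint u) * (u * mat_adjoint u) = u * ((mat_adjoint u * u) * mat_adjoint u)"
    using u by (simp add: mult_assoc_dim)
  moreover have "mat_adjoint u * u = 1\<^sub>m 1" using adjoint_mult_columns[OF u u] 1 by auto
  moreover have "1\<^sub>m 1 * mat_adjoint u = mat_adjoint u"
    using u by (intro left_mult_one_mat[of _ 1 n]) auto
  ultimately show ?thesis by simp
qed

lemma adjoint_projection [simp]: "mat_adjoint (u * mat_adjoint u) = (u * mat_adjoint u :: complex mat)"
  by (simp add: mat_adjoint_mult)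

section \<open>Kronecker products\<close>

lemma dim_kron [simp]:
  "dim_row (kron A B) = dim_row A * dim_row B" "dim_col (kron A B) = dim_col A * dim_col B"
  by (auto simp: kron_def)

lemma kron_index [simp]:
  "i < dim_row A * dim_row B \<Longrightarrow> j < dim_col A * dim_col B \<Longrightarrow> kron A B $$ (i, j) =
    A $$ (i div dim_row B, j div dim_col B) * B $$ (i mod dim_row B, j mod dim_col B)"
  by (auto simp: kron_def)

lemma div_mod_less_mult:
  assumes "(i :: nat) < a * b"
  shows "i div b < a" "i mod b < b"
proof -
  have "b > 0" using assms by (cases b) auto
  then show "i div b < a" "i mod b < b" using assms by (auto simp: less_mult_imp_div_less)
qed

text \<open>An index below \<open>a * b\<close> is a pair of digits; this is the reindexing behind
  both the product and the trace of Kronecker products.\<close>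

lemma sum_div_mod:
  fixes a b :: nat and f :: "nat \<Rightarrow> nat \<Rightarrow> 'a :: comm_monoid_add"
  shows "(\<Sum>l<a * b. f (l div b) (l mod b)) = (\<Sum>p<a. \<Sum>q<b. f p q)"
proof -
  have "(\<Sum>l<a * b. f (l div b) (l mod b)) = (\<Sum>p<a. \<Sum>l=p*b..<p*b+b. f (l div b) (l mod b))"
    by (rule sum.nat_group[symmetric])
  also have "\<dots> = (\<Sum>p<a. \<Sum>q<b. f p q)"
  proof (rule sum.cong[OF refl])
    fix p
    have "(\<Sum>l=p*b..<p*b+b. f (l div b) (l mod b)) = (\<Sum>q=0..<b. f ((q + p*b) div b) ((q + p*b) mod b))"
      using sum.shift_bounds_nat_ivl[of "\<lambda>l. f (l div b) (l mod b)" 0 "p*b" b] by (simp add: add.commute)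
    then show "(\<Sum>l=p*b..<p*b+b. f (l div b) (l mod b)) = (\<Sum>q<b. f p q)"
      by (simp add: lessThan_atLeast0)
  qed
  finally show ?thesis .
qed

lemma kron_mult:
  assumes "dim_col A = dim_row C" "dim_col B = dim_row D"
  shows "kron A B * kron C D = kron (A * C) (B * D)"
proof (rule eq_matI, goal_cases)
  case (1 i j)
  then have i: "i < dim_row A * dim_row B" and j: "j < dim_col C * dim_col D" by auto
  note b = div_mod_less_mult[OF i] div_mod_less_mult[OF j]
  have "(kron A B * kron C D) $$ (i, j) = (\<Sum>l<dim_row C * dim_row D.
      (A $$ (i div dim_row B, l div dim_row D) * B $$ (i mod dim_row B, l mod dim_row D)) *
      (C $$ (l div dim_row D, j div dim_col D) * D $$ (l mod dim_row D, j mod dim_col D)))"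
    using i j assms by (subst mat_mult_index_sum) auto
  also have "\<dots> = (\<Sum>p<dim_row C. \<Sum>q<dim_row D.
      (A $$ (i div dim_row B, p) * B $$ (i mod dim_row B, q)) *
      (C $$ (p, j div dim_col D) * D $$ (q, j mod dim_col D)))"
    by (rule sum_div_mod)
  also have "\<dots> = (A * C) $$ (i div dim_row B, j div dim_col D) * (B * D) $$ (i mod dim_row B, j mod dim_col D)"
    using b assms by (simp add: mat_mult_index_sum sum_product mult_ac del: index_mult_mat(1))
  finally show ?case using i j by simp
qed auto

lemma kron_adjoint: "mat_adjoint (kron A B) = kron (mat_adjoint A) (mat_adjoint B)"
  by (rule eq_matI) (auto simp: div_mod_less_mult)

lemma kron_one: "kron (1\<^sub>m a) (1\<^sub>m b) = 1\<^sub>m (a * b)"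
proof (rule eq_matI, goal_cases)
  case (1 i j)
  then have "i < a * b" "j < a * b" by auto
  moreover have "i = j \<longleftrightarrow> i div b = j div b \<and> i mod b = j mod b"
    by (metis div_mult_mod_eq)
  ultimately show ?case by (auto simp: div_mod_less_mult)
qed auto

lemma tr_kron:
  assumes "dim_row A = dim_col A" "dim_row B = dim_col B"
  shows "tr (kron A B) = tr A * tr B"
proof -
  have "tr (kron A B) = (\<Sum>l<dim_row A * dim_row B. A $$ (l div dim_row B, l div dim_row B) *
      B $$ (l mod dim_row B, l mod dim_row B))"
    using assms by (simp add: tr_def)
  also have "\<dots> = (\<Sum>p<dim_row A. \<Sum>q<dim_row B. A $$ (p, p) * B $$ (q, q))"
    by (rule sum_div_mod)
  finally show ?thesis by (simp add: tr_def sum_product)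
qed

section \<open>Tensor products of lists of matrices\<close>

lemma tensor_simps [simp]: "tensor [] = 1\<^sub>m 1" "tensor (A # As) = kron A (tensor As)"
  by (auto simp: tensor_def)

lemma dim_tensor [simp]:
  "dim_row (tensor As) = prod_list (map dim_row As)"
  "dim_col (tensor As) = prod_list (map dim_col As)"
  by (induction As) auto

lemma tensor_mult:
  assumes "list_all2 (\<lambda>A B. dim_col A = dim_row B) As Bs"
  shows "tensor As * tensor Bs = tensor (map2 (*) As Bs)"
  using assms
proof (induction rule: list_all2_induct)
  case (Cons A As B Bs)
  have "map dim_col As = map dim_row Bs"
    using Cons(2) by (induction rule: list_all2_induct) auto
  with Cons show ?case by (simp add: kron_mult)
qed auto

lemma tensor_adjoint: "mat_adjoint (tensor As) = tensor (map mat_adjoint As)"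
  by (induction As) (auto simp: kron_adjoint)

lemma tensor_one: "tensor (map 1\<^sub>m ds) = 1\<^sub>m (prod_list ds)"
  by (induction ds) (auto simp: kron_one)

lemma tr_tensor:
  "\<forall>A\<in>set As. dim_row A = dim_col A \<Longrightarrow> tr (tensor As) = (\<Prod>k<length As. tr (As ! k))"
proof (induction As)
  case Nil
  then show ?case by (simp add: tr_def)
next
  case (Cons A As)
  then have "map dim_row As = map dim_col As" by auto
  then have "dim_row (tensor As) = dim_col (tensor As)" by (simp only: dim_tensor)
  with Cons.prems have "tr (tensor (A # As)) = tr A * tr (tensor As)" by (simp add: tr_kron del: dim_tensor)
  with Cons show ?case by (simp add: prod.lessThan_Suc_shift del: prod.lessThan_Suc)
qed

text \<open>Linearity of the tensor product in slot \<open>k\<close>. It turns the completeness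
  relation of one party into that of the whole system. Since slot \<open>k\<close> is
  \<open>d\<close> x \<open>d\<close> before and after the update, the index bounds of
  \<open>As\<close> serve for all updated lists.\<close>

lemma tensor_update_sum_ops:
  assumes "k < length As" "\<And>x. x \<in> I \<Longrightarrow> E x \<in> carrier_mat d d"
    "As ! k \<in> carrier_mat d d"
    "i < prod_list (map dim_row As)" "j < prod_list (map dim_col As)"
  shows "tensor (As[k := sum_ops d E I]) $$ (i, j) = (\<Sum>x\<in>I. tensor (As[k := E x]) $$ (i, j))"
  using assms(1,3-)
proof (induction As arbitrary: k i j)
  case (Cons A As)
  show ?case
  proof (cases k)
    case 0
    with Cons.prems have A: "dim_row A = d" "dim_col A = d" by auto
    with Cons.prems have "i < d * prod_list (map dim_row As)" "j < d * prod_list (map dim_col As)" by auto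
    note b = div_mod_less_mult[OF this(1)] div_mod_less_mult[OF this(2)] this
    have "(\<Sum>x\<in>I. tensor ((A # As)[k := E x]) $$ (i, j)) = (\<Sum>x\<in>I. E x $$
        (i div prod_list (map dim_row As), j div prod_list (map dim_col As)) *
        tensor As $$ (i mod prod_list (map dim_row As), j mod prod_list (map dim_col As)))"
    proof (intro sum.cong refl)
      fix x assume "x \<in> I"
      from assms(2)[OF this] b 0 show "tensor ((A # As)[k := E x]) $$ (i, j) = E x $$
        (i div prod_list (map dim_row As), j div prod_list (map dim_col As)) *
        tensor As $$ (i mod prod_list (map dim_row As), j mod prod_list (map dim_col As))"
        by auto
    qed
    then show ?thesis using 0 b by (simp add: sum_distrib_right)
  next
    case (Suc k')
    with Cons.prems have k': "k' < length As" "As ! k' \<in> carrier_mat d d" by auto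
    have up: "map dim_row (As[k' := C]) = map dim_row As" "map dim_col (As[k' := C]) = map dim_col As"
      if "C \<in> carrier_mat d d" for C :: "complex mat"
    proof -
      have "(map dim_row As)[k' := d] = map dim_row As" "(map dim_col As)[k' := d] = map dim_col As"
        using k' by (metis carrier_matD(1) list_update_id map_update, metis carrier_matD(2) list_update_id map_update)
      then show "map dim_row (As[k' := C]) = map dim_row As" "map dim_col (As[k' := C]) = map dim_col As"
        using that by (auto simp: map_update)
    qed
    have "i < dim_row A * prod_list (map dim_row As)" "j < dim_col A * prod_list (map dim_col As)"
      using Cons.prems by auto
    note b = div_mod_less_mult[OF this(1)] div_mod_less_mult[OF this(2)] this
    show ?thesis using Suc b k' assms(2)
      by (simp add: up Cons.IH sum_distrib_left)
  qed
qed simp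

section \<open>Output probabilities of protocols\<close>

lemma local_op_mult_tensor:
  assumes k: "k < length ds" and K: "dim_col K = ds ! k" and us: "map dim_row us = ds"
  shows "local_op ds k K * tensor us = tensor (us[k := K * us ! k])"
proof -
  have l: "length us = length ds" using us by auto
  have r: "dim_row (us ! i) = ds ! i" if "i < length ds" for i using that us by auto
  have "local_op ds k K * tensor us = tensor (map2 (*) ((map 1\<^sub>m ds)[k := K]) us)"
    unfolding local_op_def using K
    by (intro tensor_mult) (use k in \<open>auto simp: list_all2_conv_all_nth l r nth_list_update\<close>)
  also have "map2 (*) ((map 1\<^sub>m ds)[k := K]) us = us[k := K * us ! k]"
    using k l r by (intro nth_equalityI) (auto simp: nth_list_update intro!: left_mult_one_mat)
  finally show ?thesis .
qed

lemma dim_local_op: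
  assumes "k < length ds" "dim_col K = ds ! k"
  shows "dim_row (local_op ds k K) = prod_list (ds[k := dim_row K])"
    "dim_col (local_op ds k K) = prod_list ds"
  using assms by (simp_all add: local_op_def map_update o_def)

lemma local_op_mult:
  assumes "k < length ds" "dim_col K = ds ! k" "dim_col A = dim_row K"
  shows "local_op (ds[k := dim_row K]) k A * local_op ds k K = local_op ds k (A * K)"
  unfolding local_op_def[of ds]
  by (subst local_op_mult_tensor) (use assms in \<open>auto simp: map_update o_def\<close>)

text \<open>Slot \<open>k\<close> of the identities is overwritten, so \<open>n\<close> is free; it
  is later taken as \<open>dim_row K\<close>, which makes the adjoint composable with
  \<open>local_op ds k K\<close> by \<open>local_op_mult\<close>.\<close>

lemma local_op_adjoint:
  "mat_adjoint (local_op ds k K) = local_op (ds[k := n]) k (mat_adjoint K)"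
  by (simp add: local_op_def tensor_adjoint map_update o_def)

text \<open>Cyclicity of the trace brings the adjoint to the front, where the two local operators
  merge into that of \<open>mat_adjoint (K i) * K i\<close>; these add up to the identity.
  \<open>X\<close> is an arbitrary square matrix because the lemma is later applied to off-diagonal
  terms \<open>B * mat_adjoint A\<close>.\<close>

lemma tr_local_branches:
  assumes k: "k < length ds" and X: "X \<in> carrier_mat (prod_list ds) (prod_list ds)"
    and Ks: "\<And>i. i < n \<Longrightarrow> dim_col (K i) = ds ! k"
    and 1: "sum_ops (ds ! k) (\<lambda>i. mat_adjoint (K i) * K i) {..<n} = 1\<^sub>m (ds ! k)"
  shows "(\<Sum>i<n. tr (local_op ds k (K i) * X * mat_adjoint (local_op ds k (K i)))) = tr X"
proof -
  let ?d = "prod_list ds" and ?L = "\<lambda>i. local_op ds k (K i)"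
  let ?E = "\<lambda>i. mat_adjoint (K i) * K i"
  have dL: "dim_col (?L i) = ?d" if "i < n" for i using dim_local_op[OF k] Ks that by auto
  have "tr (?L i * X * mat_adjoint (?L i)) = tr (local_op ds k (?E i) * X)" if i: "i < n" for i
  proof -
    have "tr (?L i * X * mat_adjoint (?L i)) = tr (mat_adjoint (?L i) * (?L i * X))"
      using X dL[OF i] by (intro tr_mult_commute) auto
    also have "mat_adjoint (?L i) * (?L i * X) = (mat_adjoint (?L i) * ?L i) * X"
      using X dL[OF i] by (intro mult_assoc_dim[symmetric]) auto
    also have "mat_adjoint (?L i) * ?L i = local_op ds k (?E i)"
      unfolding local_op_adjoint[of _ _ _ "dim_row (K i)"]
      using k Ks[OF i] by (intro local_op_mult) auto
    finally show ?thesis .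
  qed
  then have "(\<Sum>i<n. tr (?L i * X * mat_adjoint (?L i))) = (\<Sum>i<n. tr (local_op ds k (?E i) * X))"
    by simp
  also have "\<dots> = tr (sum_ops ?d (\<lambda>i. local_op ds k (?E i)) {..<n} * X)"
    by (rule tr_sum_ops_mult[symmetric]) (use X k Ks in \<open>auto intro!: carrier_matI simp: dim_local_op\<close>)
  also have "sum_ops ?d (\<lambda>i. local_op ds k (?E i)) {..<n} = local_op ds k (sum_ops (ds ! k) ?E {..<n})"
    by (rule eq_matI; (subst (2) local_op_def, subst tensor_update_sum_ops[where d = "ds ! k"])?)
      (use k Ks in \<open>auto simp: local_op_def[symmetric] dim_local_op o_def intro!: carrier_matI\<close>)
  also have "\<dots> = 1\<^sub>m ?d"
    unfolding 1 local_op_def using k by (metis list_update_id nth_map tensor_one)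
  finally show ?thesis using X by (simp add: left_mult_one_mat[of _ ?d ?d])
qed

lemma protocol_induct [case_names Output Measure]:
  assumes "\<And>a. Q (Output a)"
    and "\<And>k bs. (\<And>K P. (K, P) \<in> set bs \<Longrightarrow> Q P) \<Longrightarrow> Q (Measure k bs)"
  shows "Q P"
  by (induction P) (use assms in \<open>force simp: snds.simps\<close>)+

lemma labels_branch: "labels (Measure k bs) \<subseteq> X \<Longrightarrow> (K, P) \<in> set bs \<Longrightarrow> labels P \<subseteq> X"
  by fastforce

lemma sum_list_pairs:
  "(\<Sum>(K, P)\<leftarrow>bs. f K P) = (\<Sum>i<length bs. f (fst (bs ! i)) (snd (bs ! i)))"
  by (simp add: sum_list_sum_nth case_prod_unfold lessThan_atLeast0)

lemma tr_branches:
  assumes "valid_protocol ds (Measure k bs)" "X \<in> carrier_mat (prod_list ds) (prod_list ds)"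
  shows "(\<Sum>(K, P)\<leftarrow>bs. tr (local_op ds k K * X * mat_adjoint (local_op ds k K))) = tr X"
  unfolding sum_list_pairs
  by (rule tr_local_branches) (use assms in \<open>auto dest!: nth_mem\<close>)

text \<open>Inputs are carried in the factored form \<open>A * mat_adjoint B\<close>, which every
  Kraus operator preserves: positivity stays visible along a branch, and a pair of vectors can be
  followed together.\<close>

lemma conjugate_mult_adjoint:
  fixes L A B :: "complex mat"
  assumes "dim_col L = dim_row A" "dim_row B = dim_row A" "dim_col A = dim_col B"
  shows "L * (A * mat_adjoint B) * mat_adjoint L = (L * A) * mat_adjoint (L * B)"
  using assms by (simp add: mat_adjoint_mult mult_assoc_dim)

lemma branch_dims:
  assumes "valid_protocol ds (Measure k bs)" "(K, P) \<in> set bs"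
  shows "dim_row (local_op ds k K) = prod_list (ds[k := dim_row K])"
    "dim_col (local_op ds k K) = prod_list ds" "valid_protocol (ds[k := dim_row K]) P"
  using assms dim_local_op[of k ds K] by auto

lemma output_prob_nonneg:
  "valid_protocol ds P \<Longrightarrow> dim_row A = prod_list ds \<Longrightarrow> output_prob ds P x (A * mat_adjoint A) \<ge> 0"
proof (induction P arbitrary: ds A rule: protocol_induct)
  case (Output a)
  then show ?case by (simp add: tr_mult_adjoint_nonneg)
next
  case (Measure k bs)
  have "output_prob (ds[k := dim_row K]) P x
      (local_op ds k K * (A * mat_adjoint A) * mat_adjoint (local_op ds k K)) \<ge> 0" if KP: "(K, P) \<in> set bs" for K P
    using branch_dims[OF Measure.prems(1) KP] Measure.prems(2)
    by (subst conjugate_mult_adjoint) (auto intro!: Measure.IH[OF KP])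
  then show ?case by (auto intro!: sum_list_nonneg)
qed

lemma sum_output_prob:
  assumes "finite X"
  shows "valid_protocol ds P \<Longrightarrow> labels P \<subseteq> X \<Longrightarrow> \<rho> \<in> carrier_mat (prod_list ds) (prod_list ds)
    \<Longrightarrow> (\<Sum>x\<in>X. output_prob ds P x \<rho>) = tr \<rho>"
proof (induction P arbitrary: ds \<rho> rule: protocol_induct)
  case (Output a)
  then show ?case using assms by simp
next
  case (Measure k bs)
  let ?\<sigma> = "\<lambda>K. local_op ds k K * \<rho> * mat_adjoint (local_op ds k K)"
  have "(\<Sum>x\<in>X. output_prob ds (Measure k bs) x \<rho>) =
      (\<Sum>i<length bs. \<Sum>x\<in>X. output_prob (ds[k := dim_row (fst (bs ! i))]) (snd (bs ! i)) x (?\<sigma> (fst (bs ! i))))"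
    by (simp add: sum_list_pairs) (rule sum.swap)
  also have "\<dots> = (\<Sum>i<length bs. tr (?\<sigma> (fst (bs ! i))))"
  proof (intro sum.cong refl)
    fix i assume "i \<in> {..<length bs}"
    then have KP: "(fst (bs ! i), snd (bs ! i)) \<in> set bs" by simp
    note branch = branch_dims[OF Measure.prems(1) KP]
    have "labels (snd (bs ! i)) \<subseteq> X" by (rule labels_branch[OF Measure.prems(2) KP])
    moreover have "?\<sigma> (fst (bs ! i)) \<in>
        carrier_mat (prod_list (ds[k := dim_row (fst (bs ! i))])) (prod_list (ds[k := dim_row (fst (bs ! i))]))"
      using branch(1) by (intro carrier_matI) simp_all
    ultimately show "(\<Sum>x\<in>X. output_prob (ds[k := dim_row (fst (bs ! i))]) (snd (bs ! i)) x (?\<sigma> (fst (bs ! i)))) =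
        tr (?\<sigma> (fst (bs ! i)))"
      by (rule Measure.IH[OF KP branch(3)])
  qed
  also have "\<dots> = tr \<rho>" using tr_branches[OF Measure.prems(1,3)] by (simp add: sum_list_pairs)
  finally show ?case .
qed

section \<open>Perfect separation forces orthogonality\<close>

lemma tr_mult_adjoint_eq_0:
  assumes "tr (A * mat_adjoint A) = 0" "dim_row B = dim_row A" "dim_col B = dim_col A"
  shows "tr (A * mat_adjoint B) = 0" "tr (B * mat_adjoint A) = 0"
proof -
  have "(\<Sum>i<dim_row A. \<Sum>j<dim_col A. A $$ (i, j) * cnj (A $$ (i, j))) = 0"
    using assms(1) by (simp add: tr_mult)
  then have "A $$ (i, j) = 0" if "i < dim_row A" "j < dim_col A" for i j
    using that by (subst (asm) sum_nonneg_eq_0_iff; (subst (asm) sum_nonneg_eq_0_iff)?)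
      (auto intro!: sum_nonneg simp: complex_norm_square[symmetric] less_eq_complex_def)
  then show "tr (A * mat_adjoint B) = 0" "tr (B * mat_adjoint A) = 0"
    using assms(2,3) by (simp_all add: tr_mult)
qed

text \<open>The probability at a node is a sum of nonnegative branch contributions, so an impossible
  output stays impossible in each branch.\<close>

lemma branch_output_zero:
  assumes valid: "valid_protocol ds (Measure k bs)" and KP: "(K, P) \<in> set bs"
    and 0: "output_prob ds (Measure k bs) x (C * mat_adjoint C) = 0"
    and C: "dim_row C = prod_list ds"
  shows "output_prob (ds[k := dim_row K]) P x
    ((local_op ds k K * C) * mat_adjoint (local_op ds k K * C)) = 0"
proof -
  note branch = branch_dims[OF valid]
  define ys where "ys = map (\<lambda>(K, P). output_prob (ds[k := dim_row K]) P x
    ((local_op ds k K * C) * mat_adjoint (local_op ds k K * C))) bs"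
  have "output_prob (ds[k := dim_row K']) P' x
      ((local_op ds k K' * C) * mat_adjoint (local_op ds k K' * C)) \<ge> 0" if "(K', P') \<in> set bs" for K' P'
    using branch[OF that] by (intro output_prob_nonneg) auto
  then have "y \<ge> 0" if "y \<in> set ys" for y using that by (auto simp: ys_def)
  moreover have "output_prob ds (Measure k bs) x (C * mat_adjoint C) = sum_list ys"
    unfolding output_prob.simps ys_def using branch C
    by (intro arg_cong[of _ _ sum_list] map_cong refl) (auto simp: conjugate_mult_adjoint)
  ultimately have "\<forall>y\<in>set ys. y = 0"
    using 0 sum_list_nonneg_eq_0_iff[of ys] by metis
  with KP show ?thesis by (auto simp: ys_def)
qed

text \<open>At a leaf one of the two traces is zero, hence that matrix is zero. At a node the
  hypothesis descends to the branches by \<open>branch_output_zero\<close>, and the conclusion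
  returns because the branch inner products sum to \<open>tr (B * mat_adjoint A)\<close>.\<close>

lemma separated_imp_orthogonal:
  assumes "valid_protocol ds P" "labels P \<subseteq> X" "dim_row A = prod_list ds" "dim_row B = prod_list ds"
    "dim_col A = dim_col B"
    "\<And>x. x \<in> X \<Longrightarrow> output_prob ds P x (A * mat_adjoint A) = 0 \<or> output_prob ds P x (B * mat_adjoint B) = 0"
  shows "tr (B * mat_adjoint A) = 0"
  using assms
proof (induction P arbitrary: ds A B rule: protocol_induct)
  case (Output a)
  from Output(6)[of a] Output(2) have "tr (A * mat_adjoint A) = 0 \<or> tr (B * mat_adjoint B) = 0" by simp
  with Output(3-5) show ?case by (auto intro: tr_mult_adjoint_eq_0)
next
  case (Measure k bs)
  note branch = branch_dims[OF Measure.prems(1)] and zero = branch_output_zero[OF Measure.prems(1)]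
  have "tr ((local_op ds k K * B) * mat_adjoint (local_op ds k K * A)) = 0" if KP: "(K, P) \<in> set bs" for K P
  proof (rule Measure.IH[OF KP branch(3)[OF KP]])
    show "labels P \<subseteq> X" by (rule labels_branch[OF Measure.prems(2) KP])
    show "output_prob (ds[k := dim_row K]) P x ((local_op ds k K * A) * mat_adjoint (local_op ds k K * A)) = 0 \<or>
      output_prob (ds[k := dim_row K]) P x ((local_op ds k K * B) * mat_adjoint (local_op ds k K * B)) = 0"
      if "x \<in> X" for x
      using Measure.prems(3,4,6) zero[OF KP] that by blast
  qed (use branch(1)[OF KP] Measure.prems(5) in simp_all)
  then have "(\<Sum>(K, P)\<leftarrow>bs. tr (local_op ds k K * (B * mat_adjoint A) * mat_adjoint (local_op ds k K))) = 0"
    using branch Measure.prems(3-5) by (intro sum_list_neutral) (auto simp: conjugate_mult_adjoint)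
  moreover have "B * mat_adjoint A \<in> carrier_mat (prod_list ds) (prod_list ds)"
    using Measure.prems(3,4) by (intro carrier_matI) simp_all
  ultimately show ?case using tr_branches[OF Measure.prems(1)] by simp
qed

section \<open>Relabelling of outcomes\<close>

lemma valid_map_protocol: "valid_protocol ds (map_protocol f P) \<longleftrightarrow> valid_protocol ds P"
proof (induction P arbitrary: ds rule: protocol_induct)
  case (Measure k bs)
  have "sum_ops (ds ! k) (\<lambda>i. mat_adjoint (fst (map (map_prod id (map_protocol f)) bs ! i)) *
        fst (map (map_prod id (map_protocol f)) bs ! i)) {..<length bs} =
      sum_ops (ds ! k) (\<lambda>i. mat_adjoint (fst (bs ! i)) * fst (bs ! i)) {..<length bs}"
    by (rule sum_ops_cong) auto
  with Measure show ?case by auto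
qed simp

lemma output_prob_map_protocol:
  assumes "finite X"
  shows "labels P \<subseteq> X \<Longrightarrow>
    output_prob ds (map_protocol f P) y \<rho> = (\<Sum>x | x \<in> X \<and> f x = y. output_prob ds P x \<rho>)"
proof (induction P arbitrary: ds \<rho> rule: protocol_induct)
  case (Output a)
  then show ?case using assms by (auto simp: sum.If_cases)
next
  case (Measure k bs)
  have "output_prob ds (map_protocol f (Measure k bs)) y \<rho> =
     (\<Sum>i<length bs. output_prob (ds[k := dim_row (fst (bs ! i))]) (map_protocol f (snd (bs ! i))) y
        (local_op ds k (fst (bs ! i)) * \<rho> * mat_adjoint (local_op ds k (fst (bs ! i)))))"
    unfolding protocol.map output_prob.simps sum_list_pairs by (intro sum.cong) auto
  also have "\<dots> = (\<Sum>i<length bs. \<Sum>x | x \<in> X \<and> f x = y. output_prob (ds[k := dim_row (fst (bs ! i))]) (snd (bs ! i)) x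
        (local_op ds k (fst (bs ! i)) * \<rho> * mat_adjoint (local_op ds k (fst (bs ! i)))))"
  proof (rule sum.cong[OF refl])
    fix i assume "i \<in> {..<length bs}"
    then have KP: "(fst (bs ! i), snd (bs ! i)) \<in> set bs" by simp
    with Measure.prems have "labels (snd (bs ! i)) \<subseteq> X" by (rule labels_branch)
    then show "output_prob (ds[k := dim_row (fst (bs ! i))]) (map_protocol f (snd (bs ! i))) y
        (local_op ds k (fst (bs ! i)) * \<rho> * mat_adjoint (local_op ds k (fst (bs ! i)))) =
      (\<Sum>x | x \<in> X \<and> f x = y. output_prob (ds[k := dim_row (fst (bs ! i))]) (snd (bs ! i)) x
        (local_op ds k (fst (bs ! i)) * \<rho> * mat_adjoint (local_op ds k (fst (bs ! i)))))"
      by (rule Measure.IH[OF KP])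
  qed
  also have "\<dots> = (\<Sum>x | x \<in> X \<and> f x = y. output_prob ds (Measure k bs) x \<rho>)"
    by (simp add: sum_list_pairs) (rule sum.swap)
  finally show ?case .
qed

section \<open>Authentication\<close>

lemma states_carrier: "\<rho> \<in> states ds \<Longrightarrow> \<rho> \<in> carrier_mat (prod_list ds) (prod_list ds)"
  by (simp add: states_def positive_op_def)

text \<open>Classical post-processing by \<open>f\<close> leaves the protocol tree alone and only
  renames its leaves, which adds up the POVM elements over the fibres of \<open>f\<close>.\<close>

lemma locc_povm_coarsen:
  assumes M: "locc_povm ds X M" and Y: "finite Y" "f ` X \<subseteq> Y"
  shows "locc_povm ds Y (\<lambda>y. sum_ops (prod_list ds) M {x \<in> X. f x = y})"
proof -
  let ?d = "prod_list ds"
  obtain P where P: "valid_protocol ds P" "labels P \<subseteq> X"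
    and prob: "\<And>\<rho> x. \<rho> \<in> states ds \<Longrightarrow> x \<in> X \<Longrightarrow> tr (M x * \<rho>) = output_prob ds P x \<rho>"
    using M unfolding locc_povm_def by auto
  have povm: "finite X" "\<And>x. x \<in> X \<Longrightarrow> positive_op ?d (M x)" "sum_ops ?d M X = 1\<^sub>m ?d"
    using M by (auto simp: locc_povm_def povm_def)
  have "sum_ops ?d (\<lambda>y. sum_ops ?d M {x \<in> X. f x = y}) Y = sum_ops ?d M X"
    by (rule eq_matI) (auto simp: sum.group[OF povm(1) Y])
  then have "povm ds Y (\<lambda>y. sum_ops ?d M {x \<in> X. f x = y})"
    using povm Y by (auto simp: povm_def intro!: positive_op_sum_ops)
  moreover have "tr (sum_ops ?d M {x \<in> X. f x = y} * \<rho>) = output_prob ds (map_protocol f P) y \<rho>"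
    if "\<rho> \<in> states ds" for \<rho> y
  proof -
    have "tr (sum_ops ?d M {x \<in> X. f x = y} * \<rho>) = (\<Sum>x | x \<in> X \<and> f x = y. tr (M x * \<rho>))"
      using povm(2) states_carrier[OF that] by (intro tr_sum_ops_mult) (auto simp: positive_op_def)
    then show ?thesis using prob[OF that] by (simp add: output_prob_map_protocol[OF povm(1) P(2)])
  qed
  moreover have "labels (map_protocol f P) \<subseteq> Y" using P(2) Y(2) by (auto simp: protocol.set_map)
  ultimately show ?thesis unfolding locc_povm_def using P(1) valid_map_protocol by blast
qed

text \<open>Run the discrimination protocol and report only whether the state it names is the one
  asked for.\<close>

lemma perfectly_discriminable_imp_complete_LRA:
  assumes S: "S \<subseteq> states ds" and "perfectly_discriminable ds S"
  shows "complete_LRA ds S"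
  unfolding complete_LRA_def locally_authenticable_def
proof
  fix \<rho> assume \<rho>: "\<rho> \<in> S"
  obtain M where M: "locc_povm ds S M"
    and disc: "\<And>\<rho> \<sigma>. \<rho> \<in> S \<Longrightarrow> \<sigma> \<in> S \<Longrightarrow> tr (M \<sigma> * \<rho>) = (if \<sigma> = \<rho> then 1 else 0)"
    using assms(2) unfolding perfectly_discriminable_def by auto
  let ?M = "\<lambda>b. sum_ops (prod_list ds) M {\<sigma> \<in> S. (\<sigma> = \<rho>) = b}"
  have "M \<rho> \<in> carrier_mat (prod_list ds) (prod_list ds)"
    using M \<rho> by (auto simp: locc_povm_def povm_def positive_op_def)
  \<comment> \<open>The fibre of the answer yes is a singleton, so the coarsened element is
    \<open>M \<rho>\<close> itself.\<close>
  moreover have "{\<sigma> \<in> S. (\<sigma> = \<rho>) = True} = {\<rho>}" using \<rho> by auto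
  ultimately have "?M True = M \<rho>" by (intro eq_matI) auto
  then show "\<exists>M. locc_povm ds (UNIV :: bool set) M \<and> tr (M True * \<rho>) = 1 \<and>
      (\<forall>\<sigma>\<in>S - {\<rho>}. tr (M True * \<sigma>) = 0)"
    using disc \<rho> locc_povm_coarsen[OF M, of UNIV "\<lambda>\<sigma>. \<sigma> = \<rho>"]
    by (intro exI[of _ ?M]) auto
qed

text \<open>The first \<open>m\<close> parties test their projections, the last of them first, so
  that the recursion runs on the number of tests still to come. The first failure ends the
  protocol.\<close>

fun product_test :: "complex mat list \<Rightarrow> nat \<Rightarrow> bool protocol" where
  "product_test ps 0 = Output True"
| "product_test ps (Suc m) = Measure m
     [(ps ! m, product_test ps m), (1\<^sub>m (dim_row (ps ! m)) - ps ! m, Output False)]"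

text \<open>Positive local dimensions are included because a valid protocol asks for Kraus operators
  with at least one row.\<close>

definition projections :: "nat list \<Rightarrow> complex mat list \<Rightarrow> bool" where
  "projections ds ps \<longleftrightarrow> length ps = length ds \<and> (\<forall>k<length ds. 0 < ds ! k \<and>
     ps ! k \<in> carrier_mat (ds ! k) (ds ! k) \<and> mat_adjoint (ps ! k) = ps ! k \<and> ps ! k * ps ! k = ps ! k)"

lemma complement_idem:
  fixes p :: "complex mat"
  assumes "p \<in> carrier_mat n n" "p * p = p"
  shows "(1\<^sub>m n - p) * (1\<^sub>m n - p) = 1\<^sub>m n - p"
proof -
  have "(1\<^sub>m n - p) * (1\<^sub>m n - p) = (1\<^sub>m n - p) * 1\<^sub>m n - (1\<^sub>m n - p) * p"
    using assms by (intro mult_minus_distrib_mat[of _ n n _ n]) auto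
  also have "(1\<^sub>m n - p) * p = 1\<^sub>m n * p - p * p"
    using assms by (intro minus_mult_distrib_mat[of _ n n _ _ n]) auto
  also have "1\<^sub>m n * p - p * p = 0\<^sub>m n n" using assms by auto
  finally show ?thesis using assms by auto
qed

lemma valid_product_test:
  assumes "projections ds ps"
  shows "m \<le> length ds \<Longrightarrow> valid_protocol ds (product_test ps m)"
proof (induction m)
  case (Suc m)
  let ?p = "ps ! m" and ?n = "ds ! m"
  have p: "?p \<in> carrier_mat ?n ?n" "mat_adjoint ?p = ?p" "?p * ?p = ?p" "0 < ?n"
    using Suc.prems assms by (auto simp: projections_def)
  have q: "mat_adjoint (1\<^sub>m ?n - ?p) * (1\<^sub>m ?n - ?p) = 1\<^sub>m ?n - ?p"
    using p by (simp add: mat_adjoint_minus[of _ ?n ?n] complement_idem)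
  let ?bs = "[(?p, product_test ps m), (1\<^sub>m ?n - ?p, Output False)]"
  have "sum_ops ?n (\<lambda>i. mat_adjoint (fst (?bs ! i)) * fst (?bs ! i)) {..<2} = 1\<^sub>m ?n"
    using p q by (intro eq_matI) (auto simp: numeral_2_eq_2)
  then show ?case using Suc p by (auto simp: numeral_2_eq_2)
qed simp

text \<open>The answer yes sits on a single leaf, the one where all tests succeed, so its
  probability comes from one accumulated operator: projections in the first \<open>m\<close> slots
  and identities behind them.\<close>

lemma output_prob_product_test:
  assumes ps: "projections ds ps"
  shows "m \<le> length ds \<Longrightarrow> \<rho> \<in> carrier_mat (prod_list ds) (prod_list ds) \<Longrightarrow>
    output_prob ds (product_test ps m) True \<rho> =
    tr (tensor (take m ps @ map 1\<^sub>m (drop m ds)) * \<rho> * mat_adjoint (tensor (take m ps @ map 1\<^sub>m (drop m ds))))"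
proof (induction m arbitrary: \<rho>)
  case 0
  then show ?case by (simp add: tensor_one right_mult_one_mat[of _ "prod_list ds" "prod_list ds"])
next
  case (Suc m)
  let ?T = "\<lambda>m. tensor (take m ps @ map 1\<^sub>m (drop m ds))" and ?L = "local_op ds m (ps ! m)"
  have ps': "length ps = length ds" "\<And>k. k < length ds \<Longrightarrow> ps ! k \<in> carrier_mat (ds ! k) (ds ! k)"
    using ps by (auto simp: projections_def)
  have m: "m < length ds" "dim_row (ps ! m) = ds ! m" "dim_col (ps ! m) = ds ! m"
    using Suc.prems(1) ps'(2)[of m] by auto
  have nth: "(take j ps @ map 1\<^sub>m (drop j ds)) ! k = (if k < j then ps ! k else 1\<^sub>m (ds ! k))"
    if "j \<le> length ds" "k < length ds" for j k
    using that ps' by (auto simp: nth_append)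
  have eq: "map2 (*) (take m ps @ map 1\<^sub>m (drop m ds)) ((map 1\<^sub>m ds)[m := ps ! m]) =
      take (Suc m) ps @ map 1\<^sub>m (drop (Suc m) ds)"
  proof (rule nth_equalityI, goal_cases)
    case (2 k)
    then have "k < length ds" using ps' m by simp
    with ps'(2)[OF this] m show ?case
      using ps'(1) by (auto simp: nth nth_list_update less_Suc_eq right_mult_one_mat left_mult_one_mat)
  qed (use ps' m in simp)
  \<comment> \<open>Slot \<open>m\<close> of \<open>?T m\<close> is still an identity, and slot
    \<open>m\<close> is the only one in which \<open>?L\<close> is not.\<close>
  have T: "?T m * ?L = ?T (Suc m)"
    unfolding local_op_def eq[symmetric]
  proof (rule tensor_mult, unfold list_all2_conv_all_nth, intro conjI allI impI, goal_cases)
    case (2 k)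
    then have "k < length ds" using ps' m by simp
    with ps'(2)[OF this] m show ?case by (auto simp: nth nth_list_update)
  qed (use ps' m in simp)
  have dT: "dim_row (?T m) = prod_list ds" "dim_col (?T m) = prod_list ds"
  proof -
    have "map dim_row (take m ps @ map 1\<^sub>m (drop m ds)) = ds" "map dim_col (take m ps @ map 1\<^sub>m (drop m ds)) = ds"
      using ps'(1) m(1)
      by (auto intro!: nth_equalityI simp: nth carrier_matD[OF ps'(2)] simp del: map_append)
    then show "dim_row (?T m) = prod_list ds" "dim_col (?T m) = prod_list ds"
      by (simp_all only: dim_tensor)
  qed
  have dL: "dim_row ?L = prod_list ds" "dim_col ?L = prod_list ds"
    using m dim_local_op[of m ds "ps ! m"] by auto
  have "output_prob ds (product_test ps (Suc m)) True \<rho> =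
      output_prob ds (product_test ps m) True (?L * \<rho> * mat_adjoint ?L)"
    using list_update_id[of ds m] by (simp add: m(2))
  also have "\<dots> = tr (?T m * (?L * \<rho> * mat_adjoint ?L) * mat_adjoint (?T m))"
    using Suc.prems dL by (intro Suc.IH) auto
  also have "?T m * (?L * \<rho> * mat_adjoint ?L) * mat_adjoint (?T m) =
      (?T m * ?L) * \<rho> * mat_adjoint (?T m * ?L)"
    using Suc.prems dL dT by (simp add: mult_assoc_dim mat_adjoint_mult del: dim_tensor)
  finally show ?case unfolding T .
qed

lemma tensor_projection:
  assumes "projections ds ps"
  shows "tensor ps \<in> carrier_mat (prod_list ds) (prod_list ds)"
    "mat_adjoint (tensor ps) = tensor ps" "tensor ps * tensor ps = tensor ps"
proof -
  have ps: "length ps = length ds" "\<And>k. k < length ds \<Longrightarrow> ps ! k \<in> carrier_mat (ds ! k) (ds ! k) \<and>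
      mat_adjoint (ps ! k) = ps ! k \<and> ps ! k * ps ! k = ps ! k"
    using assms by (auto simp: projections_def)
  have "map dim_row ps = ds" "map dim_col ps = ds"
    by (auto intro!: nth_equalityI simp: ps(1) carrier_matD[OF conjunct1[OF ps(2)]])
  then show "tensor ps \<in> carrier_mat (prod_list ds) (prod_list ds)" by (intro carrier_matI) simp_all
  have "map mat_adjoint ps = ps" using ps by (auto intro!: nth_equalityI)
  then show "mat_adjoint (tensor ps) = tensor ps" by (simp add: tensor_adjoint)
  have "map2 (*) ps ps = ps" using ps by (auto intro!: nth_equalityI)
  moreover have "list_all2 (\<lambda>A B. dim_col A = dim_row B) ps ps"
    using ps by (force simp: list_all2_conv_all_nth)
  ultimately show "tensor ps * tensor ps = tensor ps" by (simp add: tensor_mult)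
qed

lemma locc_povm_product_test:
  assumes ps: "projections ds ps"
  shows "locc_povm ds UNIV (\<lambda>b. if b then tensor ps else 1\<^sub>m (prod_list ds) - tensor ps)"
proof -
  let ?d = "prod_list ds" and ?R = "tensor ps" and ?P = "product_test ps (length ds)"
  note R = tensor_projection[OF ps]
  have "positive_op ?d ?R" using positive_op_adjoint_mult[of ?R ?d ?d] R by simp
  moreover have "positive_op ?d (1\<^sub>m ?d - ?R)"
    using positive_op_adjoint_mult[of "1\<^sub>m ?d - ?R" ?d ?d] R
    by (simp add: mat_adjoint_minus[of _ ?d ?d] complement_idem minus_carrier_mat)
  moreover have "sum_ops ?d (\<lambda>b. if b then ?R else 1\<^sub>m ?d - ?R) UNIV = 1\<^sub>m ?d"
    using R(1) by (intro eq_matI) (auto simp: UNIV_bool simp del: dim_tensor)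
  ultimately have "povm ds UNIV (\<lambda>b. if b then ?R else 1\<^sub>m ?d - ?R)"
    by (simp add: povm_def)
  moreover have valid: "valid_protocol ds ?P" by (rule valid_product_test[OF ps]) simp
  moreover have "tr ((if b then ?R else 1\<^sub>m ?d - ?R) * \<rho>) = output_prob ds ?P b \<rho>"
    if "\<rho> \<in> states ds" for \<rho> b
  proof -
    note \<rho> = states_carrier[OF that]
    have "length ps = length ds" using ps by (simp add: projections_def)
    with \<rho> have "output_prob ds ?P True \<rho> = tr (?R * \<rho> * ?R)"
      by (simp add: output_prob_product_test[OF ps] R(2))
    also have "\<dots> = tr (?R * (?R * \<rho>))" using R(1) \<rho> by (intro tr_mult_commute) (auto simp del: dim_tensor)
    also have "?R * (?R * \<rho>) = ?R * \<rho>" using R \<rho> by (metis mult_assoc_dim carrier_matD)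
    finally have T: "output_prob ds ?P True \<rho> = tr (?R * \<rho>)" .
    have "(\<Sum>b\<in>UNIV. output_prob ds ?P b \<rho>) = tr \<rho>"
      by (rule sum_output_prob) (use valid \<rho> in auto)
    \<comment> \<open>Rejection is spread over many leaves; total probability gives its value
      without visiting them.\<close>
    then have F: "output_prob ds ?P False \<rho> = tr \<rho> - tr (?R * \<rho>)"
      by (simp add: UNIV_bool T) (metis add_diff_cancel_right')
    have "(1\<^sub>m ?d - ?R) * \<rho> = 1\<^sub>m ?d * \<rho> - ?R * \<rho>"
      using R(1) \<rho> by (intro minus_mult_distrib_mat[of _ ?d ?d _ _ ?d]) auto
    then have "tr ((1\<^sub>m ?d - ?R) * \<rho>) = tr \<rho> - tr (?R * \<rho>)"
      using R(1) \<rho> by (simp add: tr_def sum_subtractf del: dim_tensor)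
    with T F show ?thesis by simp
  qed
  ultimately show ?thesis unfolding locc_povm_def by blast
qed

section \<open>Rigid families of product states\<close>

lemma tr_tensor_mult_adjoint:
  assumes len: "length us = length ws"
    and dims: "\<And>k. k < length ws \<Longrightarrow> dim_row (us ! k) = dim_row (ws ! k) \<and> dim_col (us ! k) = dim_col (ws ! k)"
  shows "tr (tensor us * mat_adjoint (tensor ws)) = (\<Prod>k<length ws. tr (us ! k * mat_adjoint (ws ! k)))"
proof -
  have "tensor us * mat_adjoint (tensor ws) = tensor (map2 (*) us (map mat_adjoint ws))"
    unfolding tensor_adjoint by (rule tensor_mult) (use len dims in \<open>auto simp: list_all2_conv_all_nth\<close>)
  also have "tr \<dots> = (\<Prod>k<length (map2 (*) us (map mat_adjoint ws)). tr (map2 (*) us (map mat_adjoint ws) ! k))"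
    by (rule tr_tensor) (use len dims in \<open>auto simp: set_zip\<close>)
  finally show ?thesis using len by simp
qed

text \<open>Inner products of images under \<open>V\<close> become conditions on
  \<open>mat_adjoint V * V\<close>, an operator on the domain of \<open>V\<close>. This is how
  measurements on the current space are pulled back to the original one.\<close>

lemma tr_mult_adjoint_transfer:
  assumes "dim_col V = dim_row v" "dim_col V = dim_row u" "dim_col u = dim_col v"
  shows "tr ((V * v) * mat_adjoint (V * u)) = tr ((mat_adjoint V * V) * (v * mat_adjoint u))"
proof -
  have "(V * v) * mat_adjoint (V * u) = (V * (v * mat_adjoint u)) * mat_adjoint V"
    using assms by (simp add: mat_adjoint_mult mult_assoc_dim)
  also have "tr \<dots> = tr (mat_adjoint V * (V * (v * mat_adjoint u)))"
    using assms by (intro tr_mult_commute) auto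
  finally show ?thesis using assms by (simp add: mult_assoc_dim)
qed

lemma tr_smult_one_mult:
  "A \<in> carrier_mat n n \<Longrightarrow> tr ((c \<cdot>\<^sub>m 1\<^sub>m n) * A) = c * tr A"
  by (subst mult_smult_assoc_mat[of _ n n _ n]) (auto simp: tr_def sum_distrib_left)

text \<open>Each local map multiplies the squared norm of its factor by a nonzero \<open>c\<close>,
  and the squared norm of a product vector is the product of the local ones.\<close>

lemma tensor_isometries_nonzero:
  assumes "length us = length es" "length Vs = length es"
    and us: "\<And>k. k < length es \<Longrightarrow> us ! k \<in> carrier_mat (es ! k) 1 \<and> tr (us ! k * mat_adjoint (us ! k)) \<noteq> 0"
    and Vs: "\<And>k. k < length es \<Longrightarrow> Vs ! k \<in> carrier_mat (ds ! k) (es ! k) \<and>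
      (\<exists>c. c \<noteq> 0 \<and> mat_adjoint (Vs ! k) * Vs ! k = c \<cdot>\<^sub>m 1\<^sub>m (es ! k))"
  shows "tr (tensor (map2 (*) Vs us) * mat_adjoint (tensor (map2 (*) Vs us))) \<noteq> 0"
proof -
  have "tr (Vs ! k * us ! k * mat_adjoint (Vs ! k * us ! k)) \<noteq> 0" if k: "k < length es" for k
  proof -
    obtain c where "c \<noteq> 0" "mat_adjoint (Vs ! k) * Vs ! k = c \<cdot>\<^sub>m 1\<^sub>m (es ! k)"
      using Vs[OF k] by auto
    moreover have "us ! k * mat_adjoint (us ! k) \<in> carrier_mat (es ! k) (es ! k)"
      using us[OF k] by auto
    ultimately show ?thesis using us[OF k] Vs[OF k]
      by (subst tr_mult_adjoint_transfer) (auto simp: tr_smult_one_mult)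
  qed
  then show ?thesis using assms(1,2) by (subst tr_tensor_mult_adjoint) auto
qed

text \<open>
  \<open>rigid\<close> says that no party can measure nontrivially without destroying orthogonality. So along
  every branch the states have merely been moved by multiples of local isometries \<open>Vs ! k\<close>, and
  in the end two nonzero states share a leaf.
\<close>

lemma rigid_product_family_not_separated:
  fixes s :: "'i \<Rightarrow> complex mat list"
  assumes s_dims: "\<And>i. i \<in> I \<Longrightarrow> length (s i) = length es"
      "\<And>i k. i \<in> I \<Longrightarrow> k < length es \<Longrightarrow> s i ! k \<in> carrier_mat (es ! k) 1"
    and nonzero: "\<And>i k. i \<in> I \<Longrightarrow> k < length es \<Longrightarrow> tr (s i ! k * mat_adjoint (s i ! k)) \<noteq> 0"
    and rigid: "\<And>k E. k < length es \<Longrightarrow> E \<in> carrier_mat (es ! k) (es ! k) \<Longrightarrow>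
      (\<And>i j. i \<in> I \<Longrightarrow> j \<in> I \<Longrightarrow> i \<noteq> j \<Longrightarrow> tr (E * (s j ! k * mat_adjoint (s i ! k))) *
        (\<Prod>l\<in>{..<length es} - {k}. tr (s j ! l * mat_adjoint (s i ! l))) = 0) \<Longrightarrow>
      \<exists>c. E = c \<cdot>\<^sub>m 1\<^sub>m (es ! k)"
    and distinct: "a \<in> I" "b \<in> I" "a \<noteq> b"
  shows "valid_protocol ds P \<Longrightarrow> labels P \<subseteq> X \<Longrightarrow> length ds = length es \<Longrightarrow> length Vs = length es \<Longrightarrow>
    (\<And>k. k < length es \<Longrightarrow> Vs ! k \<in> carrier_mat (ds ! k) (es ! k) \<and>
      (\<exists>c. c \<noteq> 0 \<and> mat_adjoint (Vs ! k) * Vs ! k = c \<cdot>\<^sub>m 1\<^sub>m (es ! k))) \<Longrightarrow>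
    (\<And>x i j. x \<in> X \<Longrightarrow> i \<in> I \<Longrightarrow> j \<in> I \<Longrightarrow> i \<noteq> j \<Longrightarrow>
      output_prob ds P x (tensor (map2 (*) Vs (s i)) * mat_adjoint (tensor (map2 (*) Vs (s i)))) = 0 \<or>
      output_prob ds P x (tensor (map2 (*) Vs (s j)) * mat_adjoint (tensor (map2 (*) Vs (s j)))) = 0)
    \<Longrightarrow> False"
proof (induction P arbitrary: ds Vs rule: protocol_induct)
  case (Output x)
  let ?\<psi> = "\<lambda>i. tensor (map2 (*) Vs (s i))"
  have "tr (?\<psi> i * mat_adjoint (?\<psi> i)) \<noteq> 0" if i: "i \<in> I" for i
    using Output.prems(4,5) s_dims[OF i] nonzero[OF i]
    by (intro tensor_isometries_nonzero[of _ es _ ds]) auto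
  moreover have "x \<in> X" using Output.prems(2) by simp
  \<comment> \<open>Both vectors reach this leaf with nonzero trace, although its only label
    excludes one of them.\<close>
  ultimately show ?case using Output.prems(6)[OF _ distinct, of x] distinct by simp
next
  case (Measure k bs)
  note valid = Measure.prems(1) and V = Measure.prems(5)
  have k: "k < length es" using valid Measure.prems(3) by simp
  let ?\<psi> = "\<lambda>i. tensor (map2 (*) Vs (s i))"
  have d\<psi>: "map dim_row (map2 (*) Vs (s i)) = ds" "map dim_col (map2 (*) Vs (s i)) = map (\<lambda>_. 1) ds" if "i \<in> I" for i
    using s_dims(1)[OF that] Measure.prems(3,4)
    by (auto intro!: nth_equalityI simp: carrier_matD[OF s_dims(2)[OF that]] carrier_matD[OF conjunct1[OF V]])
  then have d\<psi>': "?\<psi> i \<in> carrier_mat (prod_list ds) (prod_list (map (\<lambda>_. 1) ds))" if "i \<in> I" for i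
    using that by (intro carrier_matI) (simp_all only: dim_tensor)
  have "tr (?\<psi> a * mat_adjoint (?\<psi> a)) \<noteq> 0"
    using Measure.prems(4,5) s_dims[OF distinct(1)] nonzero[OF distinct(1)]
    by (intro tensor_isometries_nonzero[of _ es _ ds]) auto
  also have "tr (?\<psi> a * mat_adjoint (?\<psi> a)) = (\<Sum>(K, P)\<leftarrow>bs. tr (local_op ds k K *
      (?\<psi> a * mat_adjoint (?\<psi> a)) * mat_adjoint (local_op ds k K)))"
    using d\<psi>'[OF distinct(1)] by (intro tr_branches[OF valid, symmetric]) auto
  finally have branch_sum: "(\<Sum>(K, P)\<leftarrow>bs. tr (local_op ds k K *
      (?\<psi> a * mat_adjoint (?\<psi> a)) * mat_adjoint (local_op ds k K))) \<noteq> 0" .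
  \<comment> \<open>A branch of probability zero could make the new local map vanish; a nonzero sum
    supplies a branch that \<open>a\<close> does reach.\<close>
  have "\<exists>(K, P)\<in>set bs. tr (local_op ds k K * (?\<psi> a * mat_adjoint (?\<psi> a)) * mat_adjoint (local_op ds k K)) \<noteq> 0"
  proof (rule ccontr)
    assume "\<not> ?thesis"
    then have "(\<Sum>(K, P)\<leftarrow>bs. tr (local_op ds k K *
      (?\<psi> a * mat_adjoint (?\<psi> a)) * mat_adjoint (local_op ds k K))) = 0"
      by (intro sum_list_neutral) auto
    with branch_sum show False by contradiction
  qed
  then obtain K P where KP: "(K, P) \<in> set bs"
    and branch_nonzero: "tr (local_op ds k K * (?\<psi> a * mat_adjoint (?\<psi> a)) * mat_adjoint (local_op ds k K)) \<noteq> 0"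
    by blast
  define Ws where "Ws = Vs[k := K * Vs ! k]"
  \<comment> \<open>The effect of \<open>K\<close> as seen from the original space of party
    \<open>k\<close>, where \<open>rigid\<close> applies whatever the current dimension is.\<close>
  define E where "E = mat_adjoint (K * Vs ! k) * (K * Vs ! k)"
  let ?\<phi> = "\<lambda>i. tensor (map2 (*) Ws (s i))" and ?ds = "ds[k := dim_row K]"
  note branch = branch_dims[OF valid KP]
  have K: "dim_col K = ds ! k" using valid KP by auto
  have E: "E \<in> carrier_mat (es ! k) (es ! k)" using V[OF k] by (auto simp: E_def)
  have W: "Ws ! l \<in> carrier_mat (?ds ! l) (es ! l)" if "l < length es" for l
    using V[OF that] V[OF k] k Measure.prems(3,4) by (auto simp: Ws_def nth_list_update)
  have step: "local_op ds k K * ?\<psi> i = ?\<phi> i" if i: "i \<in> I" for i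
  proof -
    have "local_op ds k K * ?\<psi> i = tensor ((map2 (*) Vs (s i))[k := K * (map2 (*) Vs (s i)) ! k])"
      using K k Measure.prems(3) d\<psi>(1)[OF i] by (intro local_op_mult_tensor) auto
    also have "(map2 (*) Vs (s i))[k := K * (map2 (*) Vs (s i)) ! k] = map2 (*) Ws (s i)"
      using k Measure.prems(3,4) s_dims(1)[OF i] s_dims(2)[OF i k] V[OF k] K
      by (intro nth_equalityI) (auto simp: Ws_def nth_list_update mult_assoc_dim)
    finally show ?thesis .
  qed
  have sep: "output_prob ?ds P x (?\<phi> i * mat_adjoint (?\<phi> i)) = 0 \<or>
      output_prob ?ds P x (?\<phi> j * mat_adjoint (?\<phi> j)) = 0"
    if "x \<in> X" "i \<in> I" "j \<in> I" "i \<noteq> j" for x i j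
    using Measure.prems(6)[OF that] branch_output_zero[OF valid KP] d\<psi>' step that(2,3)
    by (metis carrier_matD(1))
  have ip: "tr (?\<phi> j * mat_adjoint (?\<phi> i)) = tr (E * (s j ! k * mat_adjoint (s i ! k))) *
      (\<Prod>l\<in>{..<length es} - {k}. tr (mat_adjoint (Vs ! l) * Vs ! l * (s j ! l * mat_adjoint (s i ! l))))"
    if i: "i \<in> I" and j: "j \<in> I" for i j
  proof -
    have "tr (?\<phi> j * mat_adjoint (?\<phi> i)) =
        (\<Prod>l<length es. tr (Ws ! l * s j ! l * mat_adjoint (Ws ! l * s i ! l)))"
      using Measure.prems(4) s_dims(1)[OF i] s_dims(1)[OF j]
      by (subst tr_tensor_mult_adjoint)
        (auto simp: Ws_def carrier_matD[OF s_dims(2)[OF i]] carrier_matD[OF s_dims(2)[OF j]])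
    also have "\<dots> = (\<Prod>l<length es. tr (mat_adjoint (Ws ! l) * Ws ! l * (s j ! l * mat_adjoint (s i ! l))))"
    proof (rule prod.cong[OF refl])
      fix l assume "l \<in> {..<length es}"
      then have l: "l < length es" by simp
      show "tr (Ws ! l * s j ! l * mat_adjoint (Ws ! l * s i ! l)) =
          tr (mat_adjoint (Ws ! l) * Ws ! l * (s j ! l * mat_adjoint (s i ! l)))"
        using W[OF l] s_dims(2)[OF i l] s_dims(2)[OF j l] by (intro tr_mult_adjoint_transfer) auto
    qed
    also have "\<dots> = tr (mat_adjoint (Ws ! k) * Ws ! k * (s j ! k * mat_adjoint (s i ! k))) *
        (\<Prod>l\<in>{..<length es} - {k}. tr (mat_adjoint (Ws ! l) * Ws ! l * (s j ! l * mat_adjoint (s i ! l))))"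
      using k by (intro prod.remove) auto
    also have "mat_adjoint (Ws ! k) * Ws ! k = E" using k Measure.prems(4) by (simp add: Ws_def E_def)
    finally show ?thesis by (simp add: Ws_def)
  qed
  have "\<exists>e. E = e \<cdot>\<^sub>m 1\<^sub>m (es ! k)"
  proof (rule rigid[OF k E])
    fix i j assume ij: "i \<in> I" "j \<in> I" "i \<noteq> j"
    have "dim_row (?\<phi> l) = prod_list ?ds" "dim_col (?\<phi> l) = prod_list (map (\<lambda>_. 1) ds)" if "l \<in> I" for l
      using step[OF that, symmetric] branch(1) d\<psi>'[OF that] by (simp_all del: dim_tensor)
    then have "tr (?\<phi> j * mat_adjoint (?\<phi> i)) = 0"
      using sep ij by (intro separated_imp_orthogonal[OF branch(3) labels_branch[OF Measure.prems(2) KP]]) auto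
    \<comment> \<open>A vanishing product has a vanishing factor. If it belongs to a party
      \<open>l\<close> other than \<open>k\<close>, the nonzero scalar of \<open>Vs ! l\<close> is
      divided out and the original overlap at \<open>l\<close> is zero.\<close>
    then consider "tr (E * (s j ! k * mat_adjoint (s i ! k))) = 0"
      | l where "l < length es" "l \<noteq> k" "tr (mat_adjoint (Vs ! l) * Vs ! l * (s j ! l * mat_adjoint (s i ! l))) = 0"
      unfolding ip[OF ij(1,2)] by auto
    then show "tr (E * (s j ! k * mat_adjoint (s i ! k))) *
        (\<Prod>l\<in>{..<length es} - {k}. tr (s j ! l * mat_adjoint (s i ! l))) = 0"
    proof cases
      case (2 l)
      obtain c where "c \<noteq> 0" "mat_adjoint (Vs ! l) * Vs ! l = c \<cdot>\<^sub>m 1\<^sub>m (es ! l)" using V[OF 2(1)] by auto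
      moreover have "s j ! l * mat_adjoint (s i ! l) \<in> carrier_mat (es ! l) (es ! l)"
        using s_dims(2)[OF ij(1) 2(1)] s_dims(2)[OF ij(2) 2(1)] by auto
      ultimately have "tr (s j ! l * mat_adjoint (s i ! l)) = 0" using 2(3) by (simp add: tr_smult_one_mult)
      with 2 show ?thesis by auto
    qed simp
  qed
  then obtain e where e: "E = e \<cdot>\<^sub>m 1\<^sub>m (es ! k)" by auto
  \<comment> \<open>Otherwise the image of \<open>a\<close> would vanish in the branch that was
    chosen for not annihilating it.\<close>
  have "e \<noteq> 0"
  proof
    assume "e = 0"
    have "s a ! k * mat_adjoint (s a ! k) \<in> carrier_mat (es ! k) (es ! k)"
      using s_dims(2)[OF distinct(1) k] by auto
    then have "tr (E * (s a ! k * mat_adjoint (s a ! k))) = 0"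
      unfolding e \<open>e = 0\<close> by (simp add: tr_smult_one_mult)
    then have "tr (?\<phi> a * mat_adjoint (?\<phi> a)) = 0" unfolding ip[OF distinct(1,1)] by simp
    moreover have "local_op ds k K * (?\<psi> a * mat_adjoint (?\<psi> a)) * mat_adjoint (local_op ds k K) =
        ?\<phi> a * mat_adjoint (?\<phi> a)"
      using branch(2) d\<psi>'[OF distinct(1)]
      by (subst conjugate_mult_adjoint) (auto simp: step[OF distinct(1)] simp del: dim_tensor)
    ultimately show False using branch_nonzero by simp
  qed
  have "Ws ! l \<in> carrier_mat (?ds ! l) (es ! l) \<and> (\<exists>c. c \<noteq> 0 \<and> mat_adjoint (Ws ! l) * Ws ! l = c \<cdot>\<^sub>m 1\<^sub>m (es ! l))"
    if "l < length es" for l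
    using W[OF that] V[OF that] \<open>e \<noteq> 0\<close> e k Measure.prems(4) by (cases "l = k") (auto simp: Ws_def E_def)
  moreover have "length ?ds = length es" "length Ws = length es" using Measure.prems(3,4) by (simp_all add: Ws_def)
  ultimately show False
    using Measure.IH[OF KP branch(3) labels_branch[OF Measure.prems(2) KP]] sep by blast
qed

section \<open>The SHIFT states\<close>

definition ket :: "complex \<Rightarrow> complex \<Rightarrow> complex mat" where
  "ket a b = mat 2 1 (\<lambda>(i, _). if i = 0 then a else b)"

text \<open>
  The four states of the SHIFT unextendible product basis, with the basis
  \<open>(3/5, 4/5)\<close>, \<open>(4/5, -3/5)\<close> in place of \<open>(1, 1)/sqrt 2\<close>, \<open>(1, -1)/sqrt 2\<close>
  to keep all amplitudes rational. Any two of them are orthogonal at exactly one party.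
\<close>

definition shift_kets :: "nat \<Rightarrow> complex mat list" where
  "shift_kets i =
    [[ket 1 0, ket 0 1, ket (3/5) (4/5)],
     [ket 0 1, ket (3/5) (4/5), ket 1 0],
     [ket (3/5) (4/5), ket 1 0, ket 0 1],
     [ket (4/5) (-3/5), ket (4/5) (-3/5), ket (4/5) (-3/5)]] ! i"

definition shift_state :: "nat \<Rightarrow> complex mat" where
  "shift_state i = tensor (map (\<lambda>u. u * mat_adjoint u) (shift_kets i))"

abbreviation qubits :: "nat list" where
  "qubits \<equiv> [2, 2, 2]"

lemma ket_carrier [simp]: "ket a b \<in> carrier_mat 2 1" "dim_row (ket a b) = 2" "dim_col (ket a b) = 1"
  by (auto simp: ket_def)

lemma ket_index [simp]: "ket a b $$ (0, 0) = a" "ket a b $$ (Suc 0, 0) = b"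
  by (auto simp: ket_def)

lemma tr_ket [simp]: "tr (ket c d * mat_adjoint (ket a b)) = c * cnj a + d * cnj b"
  by (simp add: tr_mult numeral_2_eq_2)

lemma tr_mult_ket:
  assumes "E \<in> carrier_mat 2 2"
  shows "tr (E * (ket c d * mat_adjoint (ket a b))) =
    (E $$ (0, 0) * c + E $$ (0, 1) * d) * cnj a + (E $$ (1, 0) * c + E $$ (1, 1) * d) * cnj b"
  using assms by (simp add: tr_mult mat_mult_index_sum numeral_2_eq_2 algebra_simps del: index_mult_mat(1))

lemma less_4_cases: "(i :: nat) < 4 \<longleftrightarrow> i = 0 \<or> i = 1 \<or> i = 2 \<or> i = 3"
  by auto

lemma less_3_cases: "(k :: nat) < 3 \<longleftrightarrow> k = 0 \<or> k = 1 \<or> k = 2"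
  by auto

lemma shift_kets:
  assumes "i < 4"
  shows "length (shift_kets i) = 3"
    "k < 3 \<Longrightarrow> shift_kets i ! k \<in> carrier_mat 2 1"
    "k < 3 \<Longrightarrow> tr (shift_kets i ! k * mat_adjoint (shift_kets i ! k)) = 1"
  using assms by (auto simp: less_4_cases less_3_cases shift_kets_def)

lemma shift_kets_orthogonal:
  assumes "i < 4" "j < 4" "i \<noteq> j"
  shows "\<exists>k<3. tr (shift_kets i ! k * mat_adjoint (shift_kets j ! k)) = 0"
proof -
  have "(\<exists>k<3. P k) \<longleftrightarrow> P 0 \<or> P 1 \<or> P (2 :: nat)" for P by (auto simp: less_3_cases)
  then show ?thesis using assms unfolding less_4_cases
    by (elim disjE) (simp_all add: shift_kets_def)
qed

section \<open>Rigidity of the SHIFT kets\<close>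

lemma scalar_2x2:
  fixes E :: "complex mat"
  assumes "E \<in> carrier_mat 2 2" "E $$ (0, 1) = 0" "E $$ (1, 0) = 0" "E $$ (0, 0) = E $$ (1, 1)"
  shows "\<exists>c. E = c \<cdot>\<^sub>m 1\<^sub>m 2"
proof
  show "E = E $$ (0, 0) \<cdot>\<^sub>m 1\<^sub>m 2"
    using assms by (intro eq_matI) (auto simp: numeral_2_eq_2 less_Suc_eq)
qed

text \<open>At each party one pair of states carries the two computational basis kets, and one pair
  carries the two tilted kets; both pairs overlap at the remaining parties. The first pair, taken in
  both orders since \<open>E\<close> is not assumed Hermitian, kills the off-diagonal entries. The
  second then equates the diagonal ones.\<close>

lemma shift_rigid:
  assumes k: "k < 3" and E: "E \<in> carrier_mat 2 2"
    and orth: "\<And>i j. i < 4 \<Longrightarrow> j < 4 \<Longrightarrow> i \<noteq> j \<Longrightarrow>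
      tr (E * (shift_kets j ! k * mat_adjoint (shift_kets i ! k))) *
      (\<Prod>l\<in>{..<3} - {k}. tr (shift_kets j ! l * mat_adjoint (shift_kets i ! l))) = 0"
  shows "\<exists>c. E = c \<cdot>\<^sub>m 1\<^sub>m 2"
proof -
  have sets: "{..<3} - {0} = {1, 2 :: nat}" "{..<3} - {Suc 0} = {0, 2 :: nat}" "{..<3} - {2} = {0, 1 :: nat}"
    by auto
  note simps = shift_kets_def sets tr_mult_ket[OF E]
  consider "k = 0" | "k = 1" | "k = 2" using k by linarith
  then show ?thesis
  proof cases
    case 1
    have "E $$ (0, 1) = 0" "E $$ (1, 0) = 0" using orth[of 0 1] orth[of 1 0] by (auto simp: 1 simps)
    \<comment> \<open>With the off-diagonal entries gone, the condition is a nonzero multiple of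
      \<open>3/5 * 4/5 * (E $$ (0, 0) - E $$ (1, 1)) = 0\<close>. The other two parties are cyclic
      copies of this case.\<close>
    moreover from this have "E $$ (0, 0) = E $$ (1, 1)" using orth[of 2 3] by (auto simp: 1 simps)
    ultimately show ?thesis by (rule scalar_2x2[OF E])
  next
    case 2
    have "E $$ (0, 1) = 0" "E $$ (1, 0) = 0" using orth[of 2 0] orth[of 0 2] by (auto simp: 2 simps)
    moreover from this have "E $$ (0, 0) = E $$ (1, 1)" using orth[of 1 3] by (auto simp: 2 simps)
    ultimately show ?thesis by (rule scalar_2x2[OF E])
  next
    case 3
    have "E $$ (0, 1) = 0" "E $$ (1, 0) = 0" using orth[of 1 2] orth[of 2 1] by (auto simp: 3 simps)
    moreover from this have "E $$ (0, 0) = E $$ (1, 1)" using orth[of 0 3] by (auto simp: 3 simps)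
    ultimately show ?thesis by (rule scalar_2x2[OF E])
  qed
qed

section \<open>The SHIFT states as density operators\<close>

lemma projections_shift:
  assumes "i < 4"
  shows "projections qubits (map (\<lambda>u. u * mat_adjoint u) (shift_kets i))"
proof -
  have "length (shift_kets i) = 3" by (rule shift_kets[OF assms])
  moreover have "shift_kets i ! k * mat_adjoint (shift_kets i ! k) * (shift_kets i ! k * mat_adjoint (shift_kets i ! k)) =
      shift_kets i ! k * mat_adjoint (shift_kets i ! k)" "dim_row (shift_kets i ! k) = 2" if "k < 3" for k
    using shift_kets(2,3)[OF assms that] by (auto intro: projection_idem)
  moreover have "qubits ! k = 2" if "k < 3" for k using that by (auto simp: less_3_cases)
  ultimately show ?thesis by (auto simp: projections_def)
qed

text \<open>Links the two views of a SHIFT state: a tensor product of local projections, as the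
  authentication test uses it, and the projection onto one product vector, as the induction over
  protocols needs it.\<close>

lemma shift_state_eq:
  assumes i: "i < 4"
  shows "shift_state i = tensor (shift_kets i) * mat_adjoint (tensor (shift_kets i))"
proof -
  have "tensor (shift_kets i) * mat_adjoint (tensor (shift_kets i)) =
      tensor (map2 (*) (shift_kets i) (map mat_adjoint (shift_kets i)))"
    unfolding tensor_adjoint by (rule tensor_mult) (auto simp: list_all2_conv_all_nth)
  then show ?thesis by (simp add: shift_state_def zip_map2 zip_same_conv_map o_def)
qed

lemma tensor_shift_kets_carrier:
  assumes i: "i < 4"
  shows "tensor (shift_kets i) \<in> carrier_mat 8 1"
  using assms by (intro carrier_matI) (auto simp: less_4_cases shift_kets_def)

lemma tr_shift_kets:
  assumes "i < 4" "j < 4"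
  shows "tr (tensor (shift_kets i) * mat_adjoint (tensor (shift_kets j))) = (if i = j then 1 else 0)"
proof -
  have eq: "tr (tensor (shift_kets i) * mat_adjoint (tensor (shift_kets j))) =
      (\<Prod>k<3. tr (shift_kets i ! k * mat_adjoint (shift_kets j ! k)))"
    using tr_tensor_mult_adjoint[of "shift_kets i" "shift_kets j"]
    by (simp add: shift_kets(1) carrier_matD[OF shift_kets(2)] assms)
  show ?thesis
  proof (cases "i = j")
    case True
    then show ?thesis unfolding eq using shift_kets(3)[OF assms(1)] by simp
  next
    case False
    then obtain k where "k < 3" "tr (shift_kets i ! k * mat_adjoint (shift_kets j ! k)) = 0"
      using shift_kets_orthogonal[OF assms] by blast
    then have "(\<Prod>k<3. tr (shift_kets i ! k * mat_adjoint (shift_kets j ! k))) = 0"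
      by (intro prod_zero) auto
    with False show ?thesis unfolding eq by simp
  qed
qed

lemma tr_shift_state:
  assumes "i < 4" "j < 4"
  shows "tr (shift_state i * shift_state j) = (if i = j then 1 else 0)"
  unfolding shift_state_eq[OF assms(1)] shift_state_eq[OF assms(2)]
  using tr_shift_kets[OF assms] tr_shift_kets[OF assms(2,1)]
  by (simp add: tr_mult_projections[OF tensor_shift_kets_carrier[OF assms(2)] tensor_shift_kets_carrier[OF assms(1)]])

lemma shift_state_in_states:
  assumes "i < 4"
  shows "shift_state i \<in> states qubits"
  using positive_op_mult_adjoint[OF tensor_shift_kets_carrier[OF assms]] tr_shift_kets[OF assms assms]
  by (simp add: states_def shift_state_eq[OF assms])

text \<open>For a pure product state the operator accepted by the local tests is the state itself,
  so the acceptance probabilities are the overlaps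
  \<open>tr (shift_state i * shift_state j)\<close>.\<close>

lemma complete_LRA_shift: "complete_LRA qubits (shift_state ` {..<4})"
  unfolding complete_LRA_def locally_authenticable_def
proof
  fix \<rho> assume "\<rho> \<in> shift_state ` {..<4}"
  then obtain i where i: "i < 4" and \<rho>: "\<rho> = shift_state i" by auto
  show "\<exists>M. locc_povm qubits (UNIV :: bool set) M \<and> tr (M True * \<rho>) = 1 \<and>
      (\<forall>\<sigma>\<in>shift_state ` {..<4} - {\<rho>}. tr (M True * \<sigma>) = 0)"
    using locc_povm_product_test[OF projections_shift[OF i], folded shift_state_def] tr_shift_state[OF i]
    by (intro exI[of _ "\<lambda>b. if b then shift_state i else 1\<^sub>m (prod_list qubits) - shift_state i"])
      (auto simp: \<rho> i split: if_splits)
qed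

lemma not_perfectly_discriminable_shift: "\<not> perfectly_discriminable qubits (shift_state ` {..<4})"
proof
  let ?S = "shift_state ` {..<4}"
  assume "perfectly_discriminable qubits ?S"
  then obtain M P where P: "valid_protocol qubits P" "labels P \<subseteq> ?S"
    and prob: "\<And>\<rho> x. \<rho> \<in> states qubits \<Longrightarrow> x \<in> ?S \<Longrightarrow> tr (M x * \<rho>) = output_prob qubits P x \<rho>"
    and disc: "\<And>\<rho> \<sigma>. \<rho> \<in> ?S \<Longrightarrow> \<sigma> \<in> ?S \<Longrightarrow> tr (M \<sigma> * \<rho>) = (if \<sigma> = \<rho> then 1 else 0)"
    unfolding perfectly_discriminable_def locc_povm_def by metis
  \<comment> \<open>Before any measurement the local maps are identities, with scalar 1.\<close>
  define Vs :: "complex mat list" where "Vs = [1\<^sub>m 2, 1\<^sub>m 2, 1\<^sub>m 2]"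
  have len: "length Vs = 3" by (simp add: Vs_def)
  have es: "qubits ! k = 2" "Vs ! k = 1\<^sub>m 2" if "k < 3" for k
    using that by (auto simp: less_3_cases Vs_def)
  have ids: "map2 (*) Vs (shift_kets i) = shift_kets i" if i: "i < 4" for i
  proof (rule nth_equalityI, goal_cases)
    case (2 k)
    then have k: "k < 3" using shift_kets(1)[OF i] len by simp
    then show ?case
      using es(2)[OF k] shift_kets(1,2)[OF i] len by (simp add: left_mult_one_mat[of _ 2 1])
  qed (use shift_kets(1)[OF i] len in simp)
  show False
  proof (rule rigid_product_family_not_separated[where I = "{..<4 :: nat}" and s = shift_kets and es = qubits
        and a = 0 and b = 1 and ds = qubits and Vs = Vs and X = ?S, OF _ _ _ _ _ _ _ P])
    fix x i j assume x: "x \<in> ?S" and ij: "i \<in> {..<4 :: nat}" "j \<in> {..<4 :: nat}" "i \<noteq> j"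
    have zero: "output_prob qubits P x (shift_state l) = 0" if "l < 4" "x \<noteq> shift_state l" for l
      using prob[OF shift_state_in_states[OF that(1)] x] disc[OF _ x, of "shift_state l"] that by auto
    \<comment> \<open>The labels are the states themselves, so separation of indices needs
      injectivity: equal states would have overlap 1, not 0.\<close>
    have "shift_state i \<noteq> shift_state j" using tr_shift_state[of i j] tr_shift_state[of i i] ij by force
    then have "output_prob qubits P x (shift_state i) = 0 \<or> output_prob qubits P x (shift_state j) = 0"
      using zero ij by (cases "x = shift_state i") auto
    then show "output_prob qubits P x (tensor (map2 (*) Vs (shift_kets i)) *
          mat_adjoint (tensor (map2 (*) Vs (shift_kets i)))) = 0 \<or>
        output_prob qubits P x (tensor (map2 (*) Vs (shift_kets j)) *
          mat_adjoint (tensor (map2 (*) Vs (shift_kets j)))) = 0"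
      using ids shift_state_eq ij by simp
  next
    fix k assume "k < length qubits"
    then have k3: "k < 3" by simp
    show "Vs ! k \<in> carrier_mat (qubits ! k) (qubits ! k) \<and>
      (\<exists>c. c \<noteq> 0 \<and> mat_adjoint (Vs ! k) * Vs ! k =
        c \<cdot>\<^sub>m 1\<^sub>m (qubits ! k))"
      using es[OF k3] by (auto intro!: exI[of _ 1])
  next
    fix k and E :: "complex mat"
    assume k: "k < length qubits" and E: "E \<in> carrier_mat (qubits ! k) (qubits ! k)"
      and orth: "\<And>i j. i \<in> {..<4} \<Longrightarrow> j \<in> {..<4} \<Longrightarrow> i \<noteq> j \<Longrightarrow>
        tr (E * (shift_kets j ! k * mat_adjoint (shift_kets i ! k))) *
        (\<Prod>l\<in>{..<length qubits} - {k}. tr (shift_kets j ! l * mat_adjoint (shift_kets i ! l))) = 0"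
    have k3: "k < 3" using k by simp
    show "\<exists>c. E = c \<cdot>\<^sub>m 1\<^sub>m (qubits ! k)" unfolding es(1)[OF k3]
    proof (rule shift_rigid[OF k3])
      show "E \<in> carrier_mat 2 2" using E es(1)[OF k3] by simp
      have len3: "length qubits = 3" by simp
      show "tr (E * (shift_kets j ! k * mat_adjoint (shift_kets i ! k))) *
        (\<Prod>l\<in>{..<3} - {k}. tr (shift_kets j ! l * mat_adjoint (shift_kets i ! l))) = 0"
        if "i < 4" "j < 4" "i \<noteq> j" for i j
        using orth[of i j] that unfolding len3 by simp
    qed
  qed (use shift_kets es len in \<open>auto simp: eval_nat_numeral\<close>)
qed

theorem theorem1:
  shows "(\<forall>ds S. multipartite_system ds \<and> state_set ds S \<and> perfectly_discriminable ds S
            \<longrightarrow> complete_LRA ds S)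
       \<and> (\<exists>ds S. multipartite_system ds \<and> state_set ds S \<and> pairwise orthogonal_states S
            \<and> complete_LRA ds S \<and> \<not> perfectly_discriminable ds S)"
proof (intro conjI allI impI)
  fix ds S assume "multipartite_system ds \<and> state_set ds S \<and> perfectly_discriminable ds S"
  then show "complete_LRA ds S"
    by (auto simp: state_set_def intro: perfectly_discriminable_imp_complete_LRA)
next
  let ?S = "shift_state ` {..<4}"
  have "multipartite_system qubits" by (simp add: multipartite_system_def)
  moreover have "state_set qubits ?S" by (auto simp: state_set_def shift_state_in_states lessThan_empty_iff)
  moreover have "pairwise orthogonal_states ?S"
    using tr_shift_state by (auto simp: pairwise_def orthogonal_states_def split: if_splits)
  ultimately show "\<exists>ds S. multipartite_system ds \<and> state_set ds S \<and> pairwise orthogonal_states S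
      \<and> complete_LRA ds S \<and> \<not> perfectly_discriminable ds S"
    using complete_LRA_shift not_perfectly_discriminable_shift by blast
qed

end
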